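(* Let $R,T>0$ and define $$\eta(T)=\max\left\{m\in\mathbb{N}: m<\frac{T}{\pi\sinh R}\right\}.$$ Consider the eigenvalue problem $Ju+\lambda u=0$ in $C_R^T$ with Dirichlet boundary condition $u=0$ on $\partial C_R^T$. Then $\mathrm{index}(C_R^T)=\eta(T)$. In consequence: 1. if $T>\pi\sinh R$, then $C_R^T$ is not strongly stable; 2. if $T>2\pi\sinh R$, then $C_R^T$ is not stable. As a consequence, the Killing cylinder $C_R$ is not stable.
   Context: $\mathbb{H}^3$ is the upper half-space $\{z>0\}$ with metric $(dx^2+dy^2+dz^2)/z^2$. For $R>0$ put $r=\sinh R$. The Killing cylinder $C_R$ of radius $R$ is the surface parametrized by $$\Psi(t,\theta)=e^t(r\cos\theta,r\sin\theta,1),\quad t\in\mathbb{R},\ \theta\in[0,2\pi],$$ and $C_R^T=\Psi([0,T]\times[0,2\pi])$ is the piece of $C_R$ of length $T$, bounded by two circles. In the definition of $\eta$, the maximum is understood to be $0$ if there is no positive integer $m$ with $m<T/(\pi\sinh R)$. $J=\Delta+|A|^2-2$ is the Jacobi operator, with $A$ the second fundamental form and $\Delta$ the Laplacian of the induced metric. In this theorem stability is with fixed boundary (all test functions vanish on the boundary). The quadratic form is $Q[u]=\int(|\nabla u|^2-(|A|^2-2)u^2)$ on smooth functions vanishing on $\partial C_R^T$. The (Morse) index of $C_R^T$ is the number of negative eigenvalues, counted with multiplicity, of $Ju+\lambda u=0$ in $C_R^T$, $u=0$ on $\partial C_R^T$. $C_R^T$ is strongly stable if its index is $0$, i.e. $Q[u]\ge0$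 for all smooth $u$ vanishing on $\partial C_R^T$; it is stable if $Q[u]\geq0$ for all such $u$ with $\int u=0$. The non-compact cylinder $C_R$ is stable if $Q[u]\ge0$ for all smooth compactly supported $u$ on $C_R$ with $\int_{C_R} u=0$. *)

theory Defs
  imports "HOL-Analysis.Analysis" "HOL-Library.Function_Algebras" "HOL-Library.Extended_Nat"
begin

section \<open>Partial derivatives and smooth functions\<close>

definition pd :: "'n \<Rightarrow> (real^'n \<Rightarrow> 'b::real_normed_vector) \<Rightarrow> real^'n \<Rightarrow> 'b" where
  "pd i f p = vector_derivative (\<lambda>s. f (p + s *\<^sub>R axis i 1)) (at 0)"

fun Ck :: "nat \<Rightarrow> (real^'n \<Rightarrow> real) \<Rightarrow> bool" where
  "Ck 0 f \<longleftrightarrow> continuous_on UNIV f"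
| "Ck (Suc k) f \<longleftrightarrow> (\<forall>p. f differentiable (at p)) \<and> (\<forall>i. Ck k (pd i f))"

definition smooth :: "(real^'n \<Rightarrow> real) \<Rightarrow> bool" where
  "smooth f \<longleftrightarrow> (\<forall>k. Ck k f)"


section \<open>Hyperbolic space in the upper half-space model\<close>

text \<open>A Riemannian metric on (an open subset of) a coordinate space is given by its matrix field.
  The half-space is the set of points whose third coordinate is positive.\<close>

definition hyp_metric :: "real^3 \<Rightarrow> real^3^3" where
  "hyp_metric x = mat (1 / (x $ 3)^2)"

definition hyp_inner :: "real^3 \<Rightarrow> real^3 \<Rightarrow> real^3 \<Rightarrow> real" where
  "hyp_inner x v w = v \<bullet> (hyp_metric x *v w)"

text \<open>\<open>christoffel G x k i j\<close> is the symbol with upper index \<open>k\<close> and lower indices \<open>i\<close>, \<open>j\<close>.\<close>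

definition christoffel :: "(real^'n \<Rightarrow> real^'n^'n) \<Rightarrow> real^'n \<Rightarrow> 'n \<Rightarrow> 'n \<Rightarrow> 'n \<Rightarrow> real" where
  "christoffel G x k i j =
     (1/2) * (\<Sum>l\<in>UNIV. matrix_inv (G x) $ k $ l *
        (pd i (\<lambda>y. G y $ j $ l) x + pd j (\<lambda>y. G y $ i $ l) x - pd l (\<lambda>y. G y $ i $ j) x))"


section \<open>Geometry of an immersed parametrized surface\<close>

text \<open>\<open>X\<close> is an immersion of a region of the parameter plane into the half-space. A function on the
  surface is differentiated through its expression \<open>u\<close> in the parameters.\<close>

definition first_ff :: "(real^2 \<Rightarrow> real^3) \<Rightarrow> real^2 \<Rightarrow> real^2^2" where
  "first_ff X p = (\<chi> i j. hyp_inner (X p) (pd i X p) (pd j X p))"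

definition inv_ff :: "(real^2 \<Rightarrow> real^3) \<Rightarrow> real^2 \<Rightarrow> real^2^2" where
  "inv_ff X p = matrix_inv (first_ff X p)"

text \<open>The ambient Levi-Civita derivative of \<open>pd j X\<close> in the direction \<open>pd i X\<close>.\<close>

definition cov_deriv :: "(real^2 \<Rightarrow> real^3) \<Rightarrow> real^2 \<Rightarrow> 2 \<Rightarrow> 2 \<Rightarrow> real^3" where
  "cov_deriv X p i j = pd i (pd j X) p +
     (\<chi> k. \<Sum>a\<in>UNIV. \<Sum>b\<in>UNIV.
        christoffel hyp_metric (X p) k a b * pd i X p $ a * pd j X p $ b)"

text \<open>The vector-valued second fundamental form: the component of the ambient derivative normal
  to the surface. For a unit normal \<open>N\<close> it is \<open>h i j *\<^sub>R N\<close> with \<open>h\<close> the scalar second fundamental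
  form, so the squared norm below is the usual one and involves no choice of \<open>N\<close>.\<close>

definition second_ff :: "(real^2 \<Rightarrow> real^3) \<Rightarrow> real^2 \<Rightarrow> 2 \<Rightarrow> 2 \<Rightarrow> real^3" where
  "second_ff X p i j = cov_deriv X p i j -
     (\<Sum>k\<in>UNIV. \<Sum>l\<in>UNIV.
        (inv_ff X p $ k $ l * hyp_inner (X p) (cov_deriv X p i j) (pd k X p)) *\<^sub>R pd l X p)"

definition second_ff_norm2 :: "(real^2 \<Rightarrow> real^3) \<Rightarrow> real^2 \<Rightarrow> real" where
  "second_ff_norm2 X p = (\<Sum>i\<in>UNIV. \<Sum>j\<in>UNIV. \<Sum>k\<in>UNIV. \<Sum>l\<in>UNIV.
     inv_ff X p $ i $ k * inv_ff X p $ j $ l *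
     hyp_inner (X p) (second_ff X p i j) (second_ff X p k l))"

definition area_density :: "(real^2 \<Rightarrow> real^3) \<Rightarrow> real^2 \<Rightarrow> real" where
  "area_density X p = sqrt (det (first_ff X p))"

definition laplacian :: "(real^2 \<Rightarrow> real^3) \<Rightarrow> (real^2 \<Rightarrow> real) \<Rightarrow> real^2 \<Rightarrow> real" where
  "laplacian X u p = (1 / area_density X p) *
     (\<Sum>i\<in>UNIV. pd i (\<lambda>q. area_density X q * (\<Sum>j\<in>UNIV. inv_ff X q $ i $ j * pd j u q)) p)"

definition grad_norm2 :: "(real^2 \<Rightarrow> real^3) \<Rightarrow> (real^2 \<Rightarrow> real) \<Rightarrow> real^2 \<Rightarrow> real" where
  "grad_norm2 X u p = (\<Sum>i\<in>UNIV. \<Sum>j\<in>UNIV. inv_ff X p $ i $ j * pd i u p * pd j u p)"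

definition jacobi :: "(real^2 \<Rightarrow> real^3) \<Rightarrow> (real^2 \<Rightarrow> real) \<Rightarrow> real^2 \<Rightarrow> real" where
  "jacobi X u p = laplacian X u p + (second_ff_norm2 X p - 2) * u p"

definition surf_integral :: "(real^2 \<Rightarrow> real^3) \<Rightarrow> (real^2) set \<Rightarrow> (real^2 \<Rightarrow> real) \<Rightarrow> real" where
  "surf_integral X D h = (LINT p:D|lebesgue. h p * area_density X p)"

definition jacobi_form :: "(real^2 \<Rightarrow> real^3) \<Rightarrow> (real^2) set \<Rightarrow> (real^2 \<Rightarrow> real) \<Rightarrow> real" where
  "jacobi_form X D u =
     surf_integral X D (\<lambda>p. grad_norm2 X u p - (second_ff_norm2 X p - 2) * (u p)^2)"


section \<open>Killing cylinders\<close>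

text \<open>The parameters are \<open>t = p $ 1\<close> and \<open>\<theta> = p $ 2\<close>.\<close>

definition killing_param :: "real \<Rightarrow> real^2 \<Rightarrow> real^3" where
  "killing_param R p =
     exp (p $ 1) *\<^sub>R vector [sinh R * cos (p $ 2), sinh R * sin (p $ 2), 1]"

definition cyl_domain :: "(real^2) set" where
  "cyl_domain = {p. 0 \<le> p $ 2 \<and> p $ 2 \<le> 2 * pi}"

definition piece_domain :: "real \<Rightarrow> (real^2) set" where
  "piece_domain T = {p. 0 \<le> p $ 1 \<and> p $ 1 \<le> T \<and> 0 \<le> p $ 2 \<and> p $ 2 \<le> 2 * pi}"

definition killing_cylinder :: "real \<Rightarrow> (real^3) set" where
  "killing_cylinder R = killing_param R ` cyl_domain"

definition killing_piece :: "real \<Rightarrow> real \<Rightarrow> (real^3) set" where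
  "killing_piece R T = killing_param R ` piece_domain T"

definition killing_piece_boundary :: "real \<Rightarrow> real \<Rightarrow> (real^3) set" where
  "killing_piece_boundary R T = killing_param R ` {p \<in> piece_domain T. p $ 1 = 0 \<or> p $ 1 = T}"

text \<open>Smooth functions on the compact piece (up to the boundary) that vanish on the boundary,
  represented by their extension by 0 to the whole space, so that equal functions on the piece have
  equal representatives. Smoothness is read off the \<open>2 * pi\<close>-periodic lift to the whole strip, so it
  includes smoothness across the line \<open>\<theta> = 0\<close>.\<close>

definition dirichlet_functions :: "real \<Rightarrow> real \<Rightarrow> (real^3 \<Rightarrow> real) set" where
  "dirichlet_functions R T = {f.
     (\<forall>x. x \<notin> killing_piece R T \<longrightarrow> f x = 0) \<and>
     (\<forall>x\<in>killing_piece_boundary R T. f x = 0) \<and>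
     (\<exists>v. smooth v \<and> (\<forall>p. 0 \<le> p $ 1 \<and> p $ 1 \<le> T \<longrightarrow> f (killing_param R p) = v p))}"

text \<open>The equation is imposed at interior points, where derivatives do not depend on the extension
  by 0; by continuity it then holds up to the boundary.\<close>

definition eigenspace :: "real \<Rightarrow> real \<Rightarrow> real \<Rightarrow> (real^3 \<Rightarrow> real) set" where
  "eigenspace R T \<mu> = {f \<in> dirichlet_functions R T.
     \<forall>p. 0 < p $ 1 \<and> p $ 1 < T \<longrightarrow>
       jacobi (killing_param R) (f \<circ> killing_param R) p + \<mu> * f (killing_param R p) = 0}"

definition negative_eigenvalues :: "real \<Rightarrow> real \<Rightarrow> real set" where
  "negative_eigenvalues R T = {\<mu>. \<mu> < 0 \<and> (\<exists>f\<in>eigenspace R T \<mu>. \<exists>x. f x \<noteq> 0)}"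

interpretation fun_vs: vector_space "\<lambda>(c::real) (f::'a \<Rightarrow> real) x. c * f x"
  by unfold_locales (auto simp: fun_eq_iff algebra_simps)

text \<open>The library dimension is 0 by convention on infinite-dimensional spaces, hence the case
  distinction.\<close>

definition edim :: "('a \<Rightarrow> real) set \<Rightarrow> enat" where
  "edim V = (if \<exists>B. finite B \<and> V \<subseteq> fun_vs.span B then enat (fun_vs.dim V) else \<infinity>)"

definition morse_index :: "real \<Rightarrow> real \<Rightarrow> enat" where
  "morse_index R T =
     (if finite (negative_eigenvalues R T)
      then \<Sum>\<mu>\<in>negative_eigenvalues R T. edim (eigenspace R T \<mu>) else \<infinity>)"

text \<open>Boundary points, where the extension by 0 has no derivative, form a null set and do not
  contribute to the integrals.\<close>

definition piece_strongly_stable :: "real \<Rightarrow> real \<Rightarrow> bool" where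
  "piece_strongly_stable R T \<longleftrightarrow> (\<forall>f\<in>dirichlet_functions R T.
     0 \<le> jacobi_form (killing_param R) (piece_domain T) (f \<circ> killing_param R))"

definition piece_stable :: "real \<Rightarrow> real \<Rightarrow> bool" where
  "piece_stable R T \<longleftrightarrow> (\<forall>f\<in>dirichlet_functions R T.
     surf_integral (killing_param R) (piece_domain T) (f \<circ> killing_param R) = 0 \<longrightarrow>
     0 \<le> jacobi_form (killing_param R) (piece_domain T) (f \<circ> killing_param R))"

definition compact_test_functions :: "real \<Rightarrow> (real^3 \<Rightarrow> real) set" where
  "compact_test_functions R = {f. smooth (f \<circ> killing_param R) \<and>
     (\<exists>K. compact K \<and> K \<subseteq> killing_cylinder R \<and> (\<forall>x\<in>killing_cylinder R - K. f x = 0))}"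

definition cylinder_stable :: "real \<Rightarrow> bool" where
  "cylinder_stable R \<longleftrightarrow> (\<forall>f\<in>compact_test_functions R.
     surf_integral (killing_param R) cyl_domain (f \<circ> killing_param R) = 0 \<longrightarrow>
     0 \<le> jacobi_form (killing_param R) cyl_domain (f \<circ> killing_param R))"

text \<open>The set contains 0 when \<open>T\<close> and \<open>R\<close> are positive, so the maximum is 0 if no positive integer
  qualifies.\<close>

definition eta :: "real \<Rightarrow> real \<Rightarrow> nat" where
  "eta R T = Max {m::nat. real m < T / (pi * sinh R)}"

end

theory Submission
  imports Defs
begin

text \<open>In the parameters \<open>(t, \<theta>)\<close> the Killing cylinder is flat and has constant second fundamental
form: writing \<open>r = sinh R\<close> and \<open>c = cosh R\<close>, the first fundamental form is \<open>diag(c\<^sup>2, r\<^sup>2)\<close> and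
\<open>|A|\<^sup>2 - 2 = (c/r - r/c)\<^sup>2 = 1/(c\<^sup>2 r\<^sup>2)\<close>, because the principal curvatures are \<open>c/r\<close> and \<open>r/c\<close>. Hence
\<open>J u = u\<^sub>t\<^sub>t/c\<^sup>2 + u\<^sub>\<theta>\<^sub>\<theta>/r\<^sup>2 + u/(c\<^sup>2 r\<^sup>2)\<close> (lemma \<open>jacobi_killing\<close>), and separation of variables suggests
the eigenfunctions \<open>sin(k\<pi>t/T) e\<^bsup>in\<theta>\<^esup>\<close>. Those with \<open>n \<noteq> 0\<close> have positive eigenvalue since
\<open>1/r\<^sup>2 > 1/(c\<^sup>2 r\<^sup>2)\<close>; the rotationally symmetric one with index \<open>k \<ge> 1\<close> has eigenvalue
\<open>((k\<pi>/T)\<^sup>2 - 1/r\<^sup>2)/c\<^sup>2\<close>, which is negative exactly if \<open>k < T/(\<pi> r)\<close>.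

That there are no other eigenfunctions with negative eigenvalue is shown without Fourier series. If \<open>u\<close> is
such an eigenfunction, fix an angle \<open>\<theta>\<^sub>0\<close> and consider the odd part
\<open>u(t, \<theta>\<^sub>0 + s) - u(t, \<theta>\<^sub>0 - s)\<close> on \<open>0 \<le> t \<le> T\<close>, \<open>0 \<le> s \<le> \<pi>\<close>. It solves the same equation and, by the
boundary condition and periodicity, vanishes on all four sides. On this rectangle \<open>cos(m(s - \<pi>/2))\<close> with \<open>m < 1\<close> close to \<open>1\<close> is
positive and a strict supersolution, so the maximum principle forces the odd part to vanish. Thus \<open>u\<close> is
symmetric about every meridian, hence independent of \<open>\<theta>\<close>
(lemma \<open>periodic_solution_constant_in_angle\<close>), and solves an ordinary Dirichlet problem on \<open>[0, T]\<close>
whose solutions are the sine modes (lemma \<open>dirichlet_eigenfunction_interval\<close>). Every negative eigenspace is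
therefore a line, and counting them gives the index.

The instabilities come from explicit test functions depending on \<open>t\<close> only, for which the quadratic form is
a one-dimensional integral (lemma \<open>jacobi_form_fst\<close>): the first sine mode if \<open>T > \<pi> r\<close>, and the second
one, which has mean zero, if \<open>T > 2\<pi> r\<close>. On the whole cylinder the sine is not smooth after extension by \<open>0\<close>;
there the derivative of a smooth bump function, which automatically has mean zero, is stretched by a large
factor \<open>L\<close>, so that \<open>\<integral>w'\<^sup>2\<close> becomes negligible against \<open>\<integral>w\<^sup>2\<close>.\<close>


section \<open>Geometry of the Killing cylinder\<close>

lemma pd_eqI:
  assumes "((\<lambda>s. f (p + s *\<^sub>R axis i 1)) has_vector_derivative D) (at 0)"
  shows "pd i f p = D"
  using assms unfolding pd_def by (rule vector_derivative_at)

text \<open>The parametrization and its partial derivatives all have the form \<open>e\<^sup>t h(\<theta>)\<close>, a shape that is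
invariant under the partial derivative in \<open>t\<close>; this and the next lemma therefore yield all second derivatives.\<close>

lemma pd_1_exp_scaleR:
  fixes h :: "real \<Rightarrow> real^3"
  shows "pd 1 (\<lambda>p::real^2. exp (p $ 1) *\<^sub>R h (p $ 2)) p = exp (p $ 1) *\<^sub>R h (p $ 2)"
  by (rule pd_eqI) (auto intro!: derivative_eq_intros simp: axis_def has_vector_derivative_def)

lemma pd_2_exp_scaleR:
  fixes h :: "real \<Rightarrow> real^3"
  assumes "(h has_vector_derivative h') (at (p $ 2))"
  shows "pd 2 (\<lambda>p::real^2. exp (p $ 1) *\<^sub>R h (p $ 2)) p = exp (p $ 1) *\<^sub>R h'"
proof (rule pd_eqI)
  have "((\<lambda>s. h (p $ 2 + s)) has_vector_derivative h') (at 0)"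
  proof -
    have "((\<lambda>s. p $ 2 + s) has_vector_derivative 1) (at 0)"
      by (auto intro!: derivative_eq_intros)
    then have "(h \<circ> (\<lambda>s. p $ 2 + s) has_vector_derivative 1 *\<^sub>R h') (at 0)"
      by (rule vector_diff_chain_at) (use assms in simp)
    then show ?thesis by (simp add: o_def)
  qed
  then show "((\<lambda>s. exp ((p + s *\<^sub>R axis 2 1) $ 1) *\<^sub>R h ((p + s *\<^sub>R axis 2 1) $ 2))
     has_vector_derivative exp (p $ 1) *\<^sub>R h') (at 0)"
    by (auto intro!: derivative_eq_intros simp: axis_def)
qed

lemma has_vector_derivative_vector3:
  fixes a b c :: "real \<Rightarrow> real"
  assumes "(a has_real_derivative a') (at x)" "(b has_real_derivative b') (at x)"
    "(c has_real_derivative c') (at x)"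
  shows "((\<lambda>x. vector [a x, b x, c x] :: real^3) has_vector_derivative vector [a', b', c']) (at x)"
proof -
  have eq: "(vector [u, v, w] :: real^3) = u *\<^sub>R axis 1 1 + v *\<^sub>R axis 2 1 + w *\<^sub>R axis 3 1" for u v w :: real
    by (simp add: vec_eq_iff forall_3 axis_def)
  show ?thesis unfolding eq
    using assms by (auto intro!: derivative_eq_intros)
qed

lemma pd_1_killing: "pd 1 (killing_param R) = killing_param R"
  unfolding killing_param_def[abs_def]
  by (rule ext, rule pd_1_exp_scaleR[where h = "\<lambda>s. vector [sinh R * cos s, sinh R * sin s, 1]"])

lemma pd_2_killing:
  "pd 2 (killing_param R) =
     (\<lambda>p. exp (p $ 1) *\<^sub>R vector [- (sinh R * sin (p $ 2)), sinh R * cos (p $ 2), 0])"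
  unfolding killing_param_def[abs_def]
  by (intro ext pd_2_exp_scaleR has_vector_derivative_vector3) (auto intro!: derivative_eq_intros)

lemma pd_1_pd_2_killing: "pd 1 (pd 2 (killing_param R)) = pd 2 (killing_param R)"
  unfolding pd_2_killing
  by (rule ext,
      rule pd_1_exp_scaleR[where h = "\<lambda>s. vector [- (sinh R * sin s), sinh R * cos s, 0]"])

lemma pd_2_pd_2_killing:
  "pd 2 (pd 2 (killing_param R)) =
     (\<lambda>p. exp (p $ 1) *\<^sub>R vector [- (sinh R * cos (p $ 2)), - (sinh R * sin (p $ 2)), 0])"
  unfolding pd_2_killing
  by (intro ext pd_2_exp_scaleR has_vector_derivative_vector3) (auto intro!: derivative_eq_intros)

lemma matrix_inv_eqI:
  fixes A B :: "real^'n^'n"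
  assumes "A ** B = mat 1" shows "matrix_inv A = B"
proof -
  have "A ** matrix_inv A = mat 1 \<and> matrix_inv A ** A = mat 1"
    unfolding matrix_inv_def
    by (rule someI[of _ B]) (use assms matrix_left_right_inverse in blast)
  then show ?thesis
    by (metis assms matrix_mul_assoc matrix_mul_lid matrix_mul_rid)
qed

lemma hyp_inner_eq: "hyp_inner x v w = (v \<bullet> w) / (x $ 3)^2"
proof -
  have "hyp_metric x *v w = (1 / (x $ 3)^2) *\<^sub>R w"
    by (simp add: hyp_metric_def vec_eq_iff forall_3 matrix_vector_mult_def mat_def sum_3)
  then show ?thesis by (simp add: hyp_inner_def)
qed

lemma pd_hyp_metric:
  assumes "x $ 3 \<noteq> 0"
  shows "pd i (\<lambda>y. hyp_metric y $ j $ l) x = (if i = 3 \<and> j = l then - 2 / (x $ 3)^3 else 0)"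
proof (rule pd_eqI)
  show "((\<lambda>s. hyp_metric (x + s *\<^sub>R axis i 1) $ j $ l) has_vector_derivative (if i = 3 \<and> j = l then - 2 / (x $ 3)^3 else 0)) (at 0)"
    using assms unfolding hyp_metric_def mat_def
    by (cases "j = l"; cases "i = 3") (auto simp: axis_def has_real_derivative_iff_has_vector_derivative[symmetric]
       power_eq_if field_simps intro!: derivative_eq_intros)
qed

lemma christoffel_hyp_metric:
  assumes "x $ 3 \<noteq> 0"
  shows "christoffel hyp_metric x k i j =
    - (of_bool (i = 3 \<and> j = k) + of_bool (j = 3 \<and> i = k) - of_bool (k = 3 \<and> i = j)) / x $ 3"
proof -
  have inv: "matrix_inv (hyp_metric x) = mat ((x $ 3)^2)"
    by (rule matrix_inv_eqI)
       (use assms in \<open>simp add: hyp_metric_def matrix_matrix_mult_def mat_def vec_eq_iff sum_3 forall_3\<close>)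
  have contract: "(\<Sum>l\<in>UNIV. mat a $ k $ l * F l) = a * F k" for a :: real and F
    by (simp add: mat_def if_distrib if_distribR cong: if_cong)
  show ?thesis
    unfolding christoffel_def inv contract pd_hyp_metric[OF assms]
    using assms by (auto simp: field_simps power2_eq_square power3_eq_cube)
qed

text \<open>In closed form the bilinear Christoffel term is built from the Euclidean inner product and the
vertical direction only; so the covariant derivatives below need no sum over indices.\<close>

lemma christoffel_contract:
  assumes "x $ 3 \<noteq> 0"
  shows "(\<chi> k. \<Sum>a\<in>UNIV. \<Sum>b\<in>UNIV. christoffel hyp_metric x k a b * v $ a * w $ b) =
    (1 / x $ 3) *\<^sub>R ((v \<bullet> w) *\<^sub>R axis 3 1 - v $ 3 *\<^sub>R w - w $ 3 *\<^sub>R v)"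
  unfolding christoffel_hyp_metric[OF assms]
  using assms by (simp add: vec_eq_iff forall_3 sum_3 axis_def inner_vec_def field_simps)

lemma polar_squares: "(a * cos x)^2 + (a * sin x)^2 = (a::real)^2"
  unfolding power_mult_distrib distrib_left[symmetric] by simp

lemma killing_inner:
  "killing_param R p \<bullet> killing_param R p = (exp (p $ 1))^2 * (cosh R)^2"
  "killing_param R p \<bullet> pd 2 (killing_param R) p = 0"
  "pd 2 (killing_param R) p \<bullet> killing_param R p = 0"
  "pd 2 (killing_param R) p \<bullet> pd 2 (killing_param R) p = (exp (p $ 1))^2 * (sinh R)^2"
proof -
  note * = polar_squares[of "sinh R" "p $ 2"]
  have "killing_param R p \<bullet> killing_param R p =
      (exp (p $ 1))^2 * ((sinh R * cos (p$2))^2 + (sinh R * sin (p$2))^2 + 1)"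
    by (simp add: killing_param_def inner_vec_def sum_3 algebra_simps power2_eq_square)
  then show "killing_param R p \<bullet> killing_param R p = (exp (p $ 1))^2 * (cosh R)^2"
    by (simp only: * cosh_square_eq)
  have "pd 2 (killing_param R) p \<bullet> pd 2 (killing_param R) p =
      (exp (p $ 1))^2 * ((sinh R * cos (p$2))^2 + (sinh R * sin (p$2))^2)"
    by (simp add: pd_2_killing inner_vec_def sum_3 algebra_simps power2_eq_square)
  then show "pd 2 (killing_param R) p \<bullet> pd 2 (killing_param R) p = (exp (p $ 1))^2 * (sinh R)^2"
    by (simp only: *)
  show "killing_param R p \<bullet> pd 2 (killing_param R) p = 0"
    by (simp add: killing_param_def pd_2_killing inner_vec_def sum_3 algebra_simps)
  then show "pd 2 (killing_param R) p \<bullet> killing_param R p = 0"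
    by (simp add: inner_commute)
qed

text \<open>The vector on the right is the Euclidean direction \<open>(-cos \<theta>, -sin \<theta>, sinh R)\<close> up to the factor
\<open>e\<^sup>t sinh R\<close>. It is orthogonal to both coordinate fields, so these covariant derivatives already are the second
fundamental form: the coordinate lines are lines of curvature and have no tangential acceleration.\<close>

lemma cov_deriv_killing:
  "cov_deriv (killing_param R) p i j = (if i = j then exp (p $ 1) *\<^sub>R
     vector [- (sinh R * cos (p $ 2)), - (sinh R * sin (p $ 2)), (sinh R)^2] else 0)"
proof -
  let ?X = "killing_param R" and ?Y = "pd 2 (killing_param R)"
  have z: "?X p $ 3 = exp (p $ 1)" by (simp add: killing_param_def)
  then have z0: "?X p $ 3 \<noteq> 0" by simp
  have y: "?Y p $ 3 = 0" by (simp add: pd_2_killing)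
  have "cov_deriv ?X p 1 1 = ?X p + (exp (p $ 1) * (cosh R)^2) *\<^sub>R axis 3 1 - 2 *\<^sub>R ?X p"
    unfolding cov_deriv_def christoffel_contract[OF z0] pd_1_killing killing_inner z
    by (simp add: power2_eq_square vec_eq_iff forall_3 algebra_simps)
  then have 11: "cov_deriv ?X p 1 1 = exp (p $ 1) *\<^sub>R
     vector [- (sinh R * cos (p $ 2)), - (sinh R * sin (p $ 2)), (sinh R)^2]"
    unfolding cosh_square_eq by (simp add: killing_param_def vec_eq_iff forall_3 axis_def distrib_left distrib_right)
  have 12: "cov_deriv ?X p 1 2 = 0" "cov_deriv ?X p 2 1 = 0"
    unfolding cov_deriv_def christoffel_contract[OF z0] pd_1_killing pd_1_pd_2_killing killing_inner z y
    by simp_all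
  have "cov_deriv ?X p 2 2 = pd 2 ?Y p + (exp (p $ 1) * (sinh R)^2) *\<^sub>R axis 3 1"
    unfolding cov_deriv_def christoffel_contract[OF z0] killing_inner z y
    by (simp add: power2_eq_square)
  then have 22: "cov_deriv ?X p 2 2 = exp (p $ 1) *\<^sub>R
     vector [- (sinh R * cos (p $ 2)), - (sinh R * sin (p $ 2)), (sinh R)^2]"
    unfolding pd_2_pd_2_killing by (simp add: vec_eq_iff forall_3 axis_def algebra_simps)
  show ?thesis
    using exhaust_2[of i] exhaust_2[of j] by (elim disjE) (simp_all add: 11 12 22)
qed

lemma first_ff_killing:
  "first_ff (killing_param R) p = vector [vector [(cosh R)^2, 0], vector [0, (sinh R)^2]]"
  by (simp add: first_ff_def hyp_inner_eq vec_eq_iff forall_2 pd_1_killing killing_inner)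
     (simp add: killing_param_def)

lemma inv_ff_killing:
  assumes "R > 0"
  shows "inv_ff (killing_param R) p = vector [vector [1 / (cosh R)^2, 0], vector [0, 1 / (sinh R)^2]]"
  unfolding inv_ff_def first_ff_killing
  by (rule matrix_inv_eqI)
     (use assms in \<open>simp add: matrix_matrix_mult_def mat_def vec_eq_iff forall_2 sum_2\<close>)

lemma area_density_killing:
  assumes "R > 0"
  shows "area_density (killing_param R) p = cosh R * sinh R"
  using assms by (simp add: area_density_def first_ff_killing det_2 real_sqrt_mult)

lemma second_ff_killing:
  "second_ff (killing_param R) p i j = cov_deriv (killing_param R) p i j"
proof -
  let ?N = "vector [- (sinh R * cos (p $ 2)), - (sinh R * sin (p $ 2)), (sinh R)^2] :: real^3"
  note * = polar_squares[of "sinh R" "p $ 2"]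
  have "?N \<bullet> killing_param R p = exp (p$1) * ((sinh R)^2 - ((sinh R * cos (p$2))^2 + (sinh R * sin (p$2))^2))"
    by (simp add: killing_param_def inner_vec_def sum_3 algebra_simps power2_eq_square)
  then have 1: "?N \<bullet> killing_param R p = 0" by (simp only: *) simp
  have 2: "?N \<bullet> pd 2 (killing_param R) p = 0"
    by (simp add: pd_2_killing inner_vec_def sum_3 algebra_simps)
  have "hyp_inner (killing_param R p) (cov_deriv (killing_param R) p i j) (pd k (killing_param R) p) = 0" for k
    using exhaust_2[of k] 1 2
    by (auto simp: cov_deriv_killing hyp_inner_eq pd_1_killing)
  then show ?thesis by (simp add: second_ff_def)
qed

text \<open>This is \<open>(coth R - tanh R)\<^sup>2\<close>, the squared difference of the principal curvatures, whose
product is \<open>1\<close>.\<close>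

lemma second_ff_norm2_killing:
  assumes "R > 0"
  shows "second_ff_norm2 (killing_param R) p - 2 = 1 / ((cosh R)^2 * (sinh R)^2)"
proof -
  let ?N = "vector [- (sinh R * cos (p $ 2)), - (sinh R * sin (p $ 2)), (sinh R)^2] :: real^3"
  note * = polar_squares[of "sinh R" "p $ 2"]
  have "?N \<bullet> ?N = ((sinh R * cos (p$2))^2 + (sinh R * sin (p$2))^2) + (sinh R)^4"
    by (simp add: inner_vec_def sum_3 power2_eq_square power4_eq_xxxx)
  also have "\<dots> = (sinh R)^2 * (cosh R)^2"
    unfolding * cosh_square_eq by (simp add: algebra_simps power2_eq_square power4_eq_xxxx)
  finally have N: "?N \<bullet> ?N = (sinh R)^2 * (cosh R)^2" .
  have h: "hyp_inner (killing_param R p) (second_ff (killing_param R) p i j) (second_ff (killing_param R) p k l)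
      = of_bool (i = j \<and> k = l) * ((sinh R)^2 * (cosh R)^2)" for i j k l
    by (simp add: second_ff_killing cov_deriv_killing hyp_inner_eq N)
       (simp add: killing_param_def power2_eq_square)
  have pos: "sinh R > 0" "cosh R > 0" using assms by auto
  have "second_ff_norm2 (killing_param R) p = (sinh R)^2 / (cosh R)^2 + (cosh R)^2 / (sinh R)^2"
    unfolding second_ff_norm2_def inv_ff_killing[OF assms] h
    using pos by (simp add: sum_2 field_simps)
  \<comment> \<open>Since \<open>\<kappa>\<^sub>1 \<kappa>\<^sub>2 = 1\<close> for the principal curvatures \<open>\<kappa>\<^sub>1\<close>, \<open>\<kappa>\<^sub>2\<close>, subtracting \<open>2\<close> completes the square.\<close>
  also have "\<dots> - 2 = ((cosh R)^2 - (sinh R)^2)^2 / ((cosh R)^2 * (sinh R)^2)"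
    using pos by (simp add: field_simps power2_eq_square)
  also have "(cosh R)^2 - (sinh R)^2 = 1" by (simp add: cosh_square_eq)
  finally show ?thesis by simp
qed


section \<open>Partial derivatives and the Jacobi operator\<close>

lemma pd_cmult:
  fixes f :: "real^'n \<Rightarrow> real"
  assumes "f differentiable (at p)"
  shows "pd i (\<lambda>q. k * f q) p = k * pd i f p"
proof (rule pd_eqI)
  have "((\<lambda>s. f (p + s *\<^sub>R axis i 1)) has_vector_derivative pd i f p) (at 0)"
    unfolding pd_def vector_derivative_works[symmetric]
    by (rule differentiable_compose[of f]) (use assms in \<open>auto intro!: derivative_intros\<close>)
  then show "((\<lambda>s. k * f (p + s *\<^sub>R axis i 1)) has_vector_derivative k * pd i f p) (at 0)"
    by (rule has_vector_derivative_mult_right)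
qed

text \<open>Functions on a piece of the cylinder are extended by \<open>0\<close> and lose their derivatives at the
boundary. At interior parameters this lemma replaces them by their smooth representatives.\<close>

lemma pd_cong_open:
  assumes "open U" "p \<in> U" "\<And>q. q \<in> U \<Longrightarrow> f q = g q"
  shows "pd i f p = pd i g p"
proof -
  let ?l = "\<lambda>s. p + s *\<^sub>R axis i 1"
  have "open (?l -` U)"
    by (rule open_vimage[OF assms(1)]) (intro continuous_intros)
  then have "eventually (\<lambda>s. s \<in> ?l -` U) (nhds 0)"
    by (rule eventually_nhds_in_open) (use assms(2) in simp)
  then have "eventually (\<lambda>s. f (?l s) = g (?l s)) (nhds 0)"
    by eventually_elim (use assms(3) in auto)
  then show ?thesis
    unfolding pd_def by (intro vector_derivative_cong_eq) auto
qed

text \<open>The coefficients of the Laplacian are constant in these parameters. The function \<open>u\<close> may be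
arbitrary outside \<open>U\<close>, so that the formula applies to extensions by \<open>0\<close>.\<close>

lemma jacobi_killing:
  assumes "R > 0" "open U" "p \<in> U" "\<And>q. q \<in> U \<Longrightarrow> u q = v q"
    and "\<And>i. pd i v differentiable (at p)"
  shows "jacobi (killing_param R) u p =
    pd 1 (pd 1 v) p / (cosh R)^2 + pd 2 (pd 2 v) p / (sinh R)^2 + v p / ((cosh R)^2 * (sinh R)^2)"
proof -
  have u: "pd i u q = pd i v q" if "q \<in> U" for i q
    using pd_cong_open[OF assms(2) that, of u v] assms(4) by blast
  have "pd i (\<lambda>q. area_density (killing_param R) q * (\<Sum>j\<in>UNIV. inv_ff (killing_param R) q $ i $ j * pd j u q)) p
     = (if i = 1 then sinh R / cosh R else cosh R / sinh R) * pd i (pd i v) p" for i :: 2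
  proof -
    have "pd i (\<lambda>q. area_density (killing_param R) q * (\<Sum>j\<in>UNIV. inv_ff (killing_param R) q $ i $ j * pd j u q)) p
      = pd i (\<lambda>q. (if i = 1 then sinh R / cosh R else cosh R / sinh R) * pd i v q) p"
      using exhaust_2[of i] assms(1)
      by (intro pd_cong_open[OF assms(2,3)])
         (auto simp: area_density_killing inv_ff_killing u sum_2 power2_eq_square)
    also have "\<dots> = (if i = 1 then sinh R / cosh R else cosh R / sinh R) * pd i (pd i v) p"
      by (rule pd_cmult) (rule assms(5))
    finally show ?thesis .
  qed
  then show ?thesis
    unfolding jacobi_def laplacian_def second_ff_norm2_killing[OF assms(1)] area_density_killing[OF assms(1)]
    using assms(1) assms(4)[OF assms(3)] by (simp add: sum_2 field_simps power2_eq_square)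
qed

lemma pd_comp_fst:
  fixes h :: "real \<Rightarrow> real" and p :: "real^2"
  assumes "(h has_real_derivative h') (at (p $ 1))"
  shows "pd 1 (\<lambda>p. h (p $ 1)) p = h'"
proof (rule pd_eqI)
  have "((\<lambda>s. h (p $ 1 + s)) has_real_derivative h') (at 0)"
    using assms DERIV_shift[of h h' 0 "p $ 1"] by (simp add: add.commute)
  then show "((\<lambda>s. h ((p + s *\<^sub>R axis 1 1) $ 1)) has_vector_derivative h') (at 0)"
    by (simp add: axis_def has_real_derivative_iff_has_vector_derivative)
qed

lemma pd_2_comp_fst: "pd 2 (\<lambda>p::real^2. h (p $ 1)) p = (0::real)"
  by (rule pd_eqI) (simp add: axis_def)

text \<open>Smoothness of a function of \<open>t\<close> alone is a coinductive matter: it suffices to exhibit a set of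
functions that is closed under differentiation.\<close>

lemma smooth_comp_fst:
  fixes S :: "(real \<Rightarrow> real) set"
  assumes S: "\<And>h. h \<in> S \<Longrightarrow> \<exists>h'\<in>S. \<forall>x. (h has_real_derivative h' x) (at x)"
    and "h \<in> S"
  shows "smooth (\<lambda>p::real^2. h (p $ 1))"
proof -
  have Ck0: "Ck k (\<lambda>p::real^2. 0)" for k
  proof (induction k)
    case (Suc k)
    have "pd i (\<lambda>p::real^2. 0::real) = (\<lambda>p. 0)" for i
      by (rule ext, rule pd_eqI) simp
    with Suc show ?case by simp
  qed simp
  have "Ck k (\<lambda>p::real^2. h (p $ 1))" if "h \<in> S" for k h
    using that
  proof (induction k arbitrary: h)
    case 0
    then obtain h' where "\<And>x. (h has_real_derivative h' x) (at x)" using S by blast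
    then have "continuous_on UNIV h" by (intro DERIV_continuous_on) (auto intro: has_field_derivative_at_within)
    then show ?case by (auto intro!: continuous_on_compose2[of UNIV h] continuous_intros)
  next
    case (Suc k)
    then obtain h' where h': "\<And>x. (h has_real_derivative h' x) (at x)" "h' \<in> S" using S by blast
    have "pd 1 (\<lambda>p::real^2. h (p $ 1)) = (\<lambda>p. h' (p $ 1))"
      using pd_comp_fst h'(1) by blast
    moreover have "pd 2 (\<lambda>p::real^2. h (p $ 1)) = (\<lambda>p. 0)"
      using pd_2_comp_fst by blast
    moreover have "(\<lambda>p::real^2. h (p $ 1)) differentiable (at p)" for p
    proof (rule differentiable_compose[where f = h and g = "\<lambda>p. p $ 1"])
      show "h differentiable (at (p $ 1))"
        using h'(1) real_differentiable_def by blast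
      show "(\<lambda>p::real^2. p $ 1) differentiable (at p)"
        by (intro bounded_linear_imp_differentiable bounded_linear_vec_nth)
    qed
    ultimately show ?case using Suc.IH[OF h'(2)] Ck0 by (simp add: forall_2)
  qed
  with assms(2) show ?thesis unfolding smooth_def by blast
qed

lemma smooth_sin_fst: "smooth (\<lambda>p::real^2. A * sin (\<omega> * p $ 1))"
proof -
  define F where "F a b x = a * sin (\<omega> * x) + b * cos (\<omega> * x)" for a b x :: real
  have "\<exists>h'\<in>{F a b | a b. True}. \<forall>x. (h has_real_derivative h' x) (at x)"
    if h: "h \<in> {F a b | a b. True}" for h
  proof -
    from h obtain a b where h: "h = F a b" by blast
    have "(F a b has_real_derivative F (- (b * \<omega>)) (a * \<omega>) x) (at x)" for x
      unfolding F_def[abs_def] by (auto intro!: derivative_eq_intros)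
    then show ?thesis unfolding h by blast
  qed
  then have "smooth (\<lambda>p::real^2. F A 0 (p $ 1))"
    by (rule smooth_comp_fst) auto
  then show ?thesis by (simp add: F_def)
qed

lemma smoothD:
  assumes "smooth v"
  shows "continuous_on UNIV v" "v differentiable (at p)" "pd i v differentiable (at p)"
proof -
  have "Ck 0 v" "Ck (Suc (Suc 0)) v" using assms unfolding smooth_def by blast+
  then show "continuous_on UNIV v" "v differentiable (at p)" "pd i v differentiable (at p)" by auto
qed

lemma has_derivative_pd_1:
  fixes v :: "real^2 \<Rightarrow> real"
  assumes "\<And>p. v differentiable (at p)"
  shows "((\<lambda>t. v (vector [t, s])) has_real_derivative pd 1 v (vector [t, s])) (at t)"
proof -
  let ?p = "vector [t, s] :: real^2"
  have "((\<lambda>h. v (?p + h *\<^sub>R axis 1 1)) has_vector_derivative pd 1 v ?p) (at 0)"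
    unfolding pd_def vector_derivative_works[symmetric]
    by (rule differentiable_compose[of v]) (use assms in \<open>auto intro!: derivative_intros\<close>)
  moreover have "?p + h *\<^sub>R axis 1 1 = vector [h + t, s]" for h
    by (simp add: vec_eq_iff forall_2 axis_def)
  ultimately show ?thesis
    using DERIV_shift[of "\<lambda>t. v (vector [t, s])" "pd 1 v ?p" 0 t]
    by (simp add: has_real_derivative_iff_has_vector_derivative)
qed

lemma has_derivative_pd_2:
  fixes v :: "real^2 \<Rightarrow> real"
  assumes "\<And>p. v differentiable (at p)"
  shows "((\<lambda>s. v (vector [t, s])) has_real_derivative pd 2 v (vector [t, s])) (at s)"
proof -
  let ?p = "vector [t, s] :: real^2"
  have "((\<lambda>h. v (?p + h *\<^sub>R axis 2 1)) has_vector_derivative pd 2 v ?p) (at 0)"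
    unfolding pd_def vector_derivative_works[symmetric]
    by (rule differentiable_compose[of v]) (use assms in \<open>auto intro!: derivative_intros\<close>)
  moreover have "?p + h *\<^sub>R axis 2 1 = vector [t, h + s]" for h
    by (simp add: vec_eq_iff forall_2 axis_def)
  ultimately show ?thesis
    using DERIV_shift[of "\<lambda>s. v (vector [t, s])" "pd 2 v ?p" 0 s]
    by (simp add: has_real_derivative_iff_has_vector_derivative)
qed


section \<open>Maximum principles and the Dirichlet problem\<close>

text \<open>If \<open>D > 0\<close>, then
\<open>h' > h' x = 0\<close> immediately to the right of \<open>x\<close>, and \<open>h\<close> would increase there.\<close>

lemma second_derivative_nonpos_at_local_max:
  fixes h h' :: "real \<Rightarrow> real"
  assumes "open U" "x \<in> U"
    and h: "\<And>y. y \<in> U \<Longrightarrow> (h has_real_derivative h' y) (at y)"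
    and h': "(h' has_real_derivative D) (at x)"
    and max: "\<And>y. y \<in> U \<Longrightarrow> h y \<le> h x"
  shows "D \<le> 0"
proof (rule ccontr)
  assume "\<not> D \<le> 0"
  then obtain d where d: "d > 0" "\<And>e. 0 < e \<Longrightarrow> e < d \<Longrightarrow> h' x < h' (x + e)"
    using DERIV_pos_inc_right[OF h'] by auto
  obtain e where e: "e > 0" "ball x e \<subseteq> U"
    using assms(1,2) openE by blast
  have "\<forall>y. \<bar>x - y\<bar> < e \<longrightarrow> h y \<le> h x"
    using e max by (auto simp: dist_real_def subset_iff)
  then have "h' x = 0"
    using DERIV_local_max[OF h[OF assms(2)] e(1)] by blast
  define \<delta> where "\<delta> = min d e / 2"
  have \<delta>: "0 < \<delta>" "\<delta> < d" "\<delta> < e" using d(1) e(1) by (auto simp: \<delta>_def)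
  have U: "y \<in> U" if "x \<le> y" "y \<le> x + \<delta>" for y
    using that \<delta> e(2) by (auto simp: dist_real_def subset_iff)
  have "h x < h (x + \<delta>)"
  proof (rule DERIV_pos_imp_increasing_open[where f = h])
    show "\<exists>z. (h has_real_derivative z) (at y) \<and> 0 < z" if "x < y" "y < x + \<delta>" for y
      using d(2)[of "y - x"] h[of y] U[of y] that \<delta> \<open>h' x = 0\<close> by auto
    show "continuous_on {x..x + \<delta>} h"
      using h U by (intro DERIV_continuous_on) (auto intro: has_field_derivative_at_within)
  qed (use \<delta> in auto)
  with max[of "x + \<delta>"] U[of "x + \<delta>"] \<delta> show False by auto
qed

text \<open>The zeroth-order term may have the wrong sign for the classical maximum principle, so \<open>d\<close>
is compared with a positive function \<open>\<phi>\<close> of \<open>s\<close> satisfying \<open>b \<phi>'' + \<kappa> \<phi> < 0\<close>. At an interior maximum of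
\<open>d / \<phi>\<close> with positive value \<open>M\<close>, the function \<open>d - M \<phi>\<close> has a maximum with value \<open>0\<close>, so both its second
derivatives are nonpositive, and the equation for \<open>d\<close> is violated. Here \<open>\<kappa> < b\<close> says that \<open>\<kappa>\<close> lies below
the first Dirichlet eigenvalue of \<open>- b d\<^sup>2/ds\<^sup>2\<close> on \<open>[0, \<pi>]\<close>.\<close>

lemma elliptic_max_principle_rectangle:
  fixes d dt dtt ds dss :: "real \<Rightarrow> real \<Rightarrow> real"
  assumes "T > 0" "a > 0" "b > 0" "\<kappa> < b"
    and cont: "continuous_on ({0..T} \<times> {0..pi}) (\<lambda>(t, s). d t s)"
    and dt: "\<And>t s. \<lbrakk>0 < t; t < T; 0 < s; s < pi\<rbrakk> \<Longrightarrow> ((\<lambda>t. d t s) has_real_derivative dt t s) (at t)"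
    and dtt: "\<And>t s. \<lbrakk>0 < t; t < T; 0 < s; s < pi\<rbrakk> \<Longrightarrow> ((\<lambda>t. dt t s) has_real_derivative dtt t s) (at t)"
    and ds: "\<And>t s. \<lbrakk>0 < t; t < T; 0 < s; s < pi\<rbrakk> \<Longrightarrow> ((\<lambda>s. d t s) has_real_derivative ds t s) (at s)"
    and dss: "\<And>t s. \<lbrakk>0 < t; t < T; 0 < s; s < pi\<rbrakk> \<Longrightarrow> ((\<lambda>s. ds t s) has_real_derivative dss t s) (at s)"
    and eq: "\<And>t s. \<lbrakk>0 < t; t < T; 0 < s; s < pi\<rbrakk> \<Longrightarrow> a * dtt t s + b * dss t s + \<kappa> * d t s = 0"
    and bdry: "\<And>s. \<lbrakk>0 \<le> s; s \<le> pi\<rbrakk> \<Longrightarrow> d 0 s = 0" "\<And>s. \<lbrakk>0 \<le> s; s \<le> pi\<rbrakk> \<Longrightarrow> d T s = 0"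
      "\<And>t. \<lbrakk>0 \<le> t; t \<le> T\<rbrakk> \<Longrightarrow> d t 0 = 0" "\<And>t. \<lbrakk>0 \<le> t; t \<le> T\<rbrakk> \<Longrightarrow> d t pi = 0"
    and ts: "0 \<le> t0" "t0 \<le> T" "0 \<le> s0" "s0 \<le> pi"
  shows "d t0 s0 \<le> 0"
proof (rule ccontr)
  assume pos: "\<not> d t0 s0 \<le> 0"
  \<comment> \<open>The comparison function will be \<open>cos (m (s - \<pi>/2))\<close>: \<open>m\<close> near \<open>1\<close> keeps it a strict supersolution, \<open>m < 1\<close> keeps it positive at both ends.\<close>
  obtain m where m: "0 < m" "m < 1" "\<kappa> < b * m^2"
  proof -
    have "((\<lambda>m. b * m^2) \<longlongrightarrow> b * 1^2) (at_left 1)"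
      by (intro tendsto_intros)
    then have "eventually (\<lambda>m. \<kappa> < b * m^2) (at_left 1)"
      using assms(4) by (intro order_tendstoD(1)) auto
    moreover have "eventually (\<lambda>m. m \<in> {0<..<(1::real)}) (at_left 1)"
      by (rule eventually_at_left_real) simp
    ultimately have "eventually (\<lambda>m. \<kappa> < b * m^2 \<and> m \<in> {0<..<1}) (at_left 1)"
      by (rule eventually_conj)
    then show ?thesis using that eventually_happens'[OF trivial_limit_at_left_real] by force
  qed
  define \<phi> where "\<phi> s = cos (m * (s - pi / 2))" for s
  have \<phi>: "\<phi> s > 0" if "0 \<le> s" "s \<le> pi" for s
  proof -
    have "\<bar>m * (s - pi/2)\<bar> = m * \<bar>s - pi/2\<bar>" using m by (simp add: abs_mult)
    also have "\<dots> \<le> m * (pi/2)" using m that by (intro mult_left_mono) (auto simp: abs_if)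
    also have "\<dots> < pi/2" using m by simp
    finally show ?thesis unfolding \<phi>_def by (intro cos_gt_zero_pi) (auto simp: abs_if split: if_splits)
  qed
  let ?K = "{0..T} \<times> {0..pi}"
  have "\<exists>p\<in>?K. \<forall>q\<in>?K. (\<lambda>(t, s). d t s / \<phi> s) q \<le> (\<lambda>(t, s). d t s / \<phi> s) p"
  proof (rule continuous_attains_sup)
    have "continuous_on ?K (\<lambda>q. (\<lambda>(t, s). d t s) q / \<phi> (snd q))"
      using less_imp_neq[OF \<phi>]
      by (intro continuous_on_divide cont) (force simp: \<phi>_def intro!: continuous_intros)+
    then show "continuous_on ?K (\<lambda>(t, s). d t s / \<phi> s)" by (simp add: case_prod_unfold)
  qed (use assms(1) in \<open>auto intro!: compact_Times\<close>)
  then obtain t s where p: "0 \<le> t" "t \<le> T" "0 \<le> s" "s \<le> pi"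
    and le: "\<And>t' s'. \<lbrakk>0 \<le> t'; t' \<le> T; 0 \<le> s'; s' \<le> pi\<rbrakk> \<Longrightarrow> d t' s' / \<phi> s' \<le> d t s / \<phi> s"
    by force
  define M where "M = d t s / \<phi> s"
  have "0 < d t0 s0 / \<phi> s0" using pos \<phi> ts by simp
  also have "\<dots> \<le> M" unfolding M_def using le ts by blast
  finally have M: "M > 0" .
  have dM: "d t s = M * \<phi> s" using \<phi>[OF p(3,4)] by (simp add: M_def)
  have dle: "d t' s' \<le> M * \<phi> s'" if "0 \<le> t'" "t' \<le> T" "0 \<le> s'" "s' \<le> pi" for t' s'
    using le[OF that] \<phi>[OF that(3,4)] by (simp add: M_def field_simps)
  have "d t s > 0" using dM M \<phi> p by simp
  then have int: "0 < t" "t < T" "0 < s" "s < pi"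
    using p bdry[of s] bdry(3,4)[of t] by (auto simp: less_le)
  have 1: "dtt t s \<le> 0"
    by (rule second_derivative_nonpos_at_local_max[of "{0<..<T}" t "\<lambda>t. d t s" "\<lambda>t. dt t s"])
       (use int dt dtt dle dM in auto)
  have "dss t s + M * (m^2 * \<phi> s) \<le> 0"
  proof (rule second_derivative_nonpos_at_local_max[of "{0<..<pi}" s "\<lambda>s. d t s - M * \<phi> s"
        "\<lambda>s. ds t s + M * (m * sin (m * (s - pi / 2)))"])
    show "((\<lambda>s. d t s - M * \<phi> s) has_real_derivative ds t y + M * (m * sin (m * (y - pi / 2)))) (at y)"
      if "y \<in> {0<..<pi}" for y
      unfolding \<phi>_def using ds[of t y] that int
      by (auto intro!: derivative_eq_intros)
    show "((\<lambda>s. ds t s + M * (m * sin (m * (s - pi / 2)))) has_real_derivative dss t s + M * (m\<^sup>2 * \<phi> s)) (at s)"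
      unfolding \<phi>_def using dss[of t s] int
      by (auto intro!: derivative_eq_intros simp: power2_eq_square)
  qed (use int dle dM in auto)
  then have "b * dss t s + b * (M * (m^2 * \<phi> s)) \<le> 0"
    using assms(3) by (metis distrib_left mult_nonneg_nonpos less_imp_le)
  moreover have "a * dtt t s \<le> 0" using 1 assms(2) by (simp add: mult_nonneg_nonpos)
  moreover have "\<kappa> * (M * \<phi> s) < b * m^2 * (M * \<phi> s)"
    using m(3) M \<phi>[of s] p by (intro mult_strict_right_mono) auto
  ultimately show False using eq[OF int] dM by (simp add: algebra_simps)
qed

text \<open>The odd part of \<open>w\<close> about the angle \<open>c\<close> vanishes at \<open>s = 0\<close> trivially and at \<open>s = \<pi>\<close> by
periodicity, so it satisfies the boundary conditions of the maximum principle on the half turn.\<close>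

lemma periodic_solution_reflection_le:
  fixes w wt wtt ws wss :: "real \<Rightarrow> real \<Rightarrow> real"
  assumes "T > 0" "a > 0" "b > 0" "\<kappa> < b"
    and cont: "continuous_on UNIV (\<lambda>(t, s). w t s)"
    and dt: "\<And>t s. ((\<lambda>t. w t s) has_real_derivative wt t s) (at t)"
    and dtt: "\<And>t s. ((\<lambda>t. wt t s) has_real_derivative wtt t s) (at t)"
    and ds: "\<And>t s. ((\<lambda>s. w t s) has_real_derivative ws t s) (at s)"
    and dss: "\<And>t s. ((\<lambda>s. ws t s) has_real_derivative wss t s) (at s)"
    and eq: "\<And>t s. \<lbrakk>0 < t; t < T\<rbrakk> \<Longrightarrow> a * wtt t s + b * wss t s + \<kappa> * w t s = 0"
    and bdry: "\<And>s. w 0 s = 0" "\<And>s. w T s = 0"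
    and per: "\<And>t s. \<lbrakk>0 \<le> t; t \<le> T\<rbrakk> \<Longrightarrow> w t (s + 2 * pi) = w t s"
    and t: "0 \<le> t" "t \<le> T" and s: "0 \<le> s" "s \<le> pi"
  shows "w t (c + s) \<le> w t (c - s)"
proof -
  have "w t (c + s) - w t (c - s) \<le> 0"
  proof (rule elliptic_max_principle_rectangle[where d = "\<lambda>t s. w t (c + s) - w t (c - s)"
        and dt = "\<lambda>t s. wt t (c + s) - wt t (c - s)" and dtt = "\<lambda>t s. wtt t (c + s) - wtt t (c - s)"
        and ds = "\<lambda>t s. ws t (c + s) + ws t (c - s)" and dss = "\<lambda>t s. wss t (c + s) - wss t (c - s)"
        and T = T and a = a and b = b and \<kappa> = \<kappa>])
    have "continuous_on ({0..T} \<times> {0..pi}) (\<lambda>q. (\<lambda>(t, s). w t s) (fst q, c + snd q) - (\<lambda>(t, s). w t s) (fst q, c - snd q))"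
      by (intro continuous_intros continuous_on_compose2[OF cont]) auto
    then show "continuous_on ({0..T} \<times> {0..pi}) (\<lambda>(t, s). w t (c + s) - w t (c - s))"
      by (simp add: case_prod_unfold)
  next
    fix t s :: real
    show "((\<lambda>s. w t (c + s) - w t (c - s)) has_real_derivative ws t (c + s) + ws t (c - s)) (at s)"
      by (auto intro!: derivative_eq_intros DERIV_chain2[OF ds])
    show "((\<lambda>s. ws t (c + s) + ws t (c - s)) has_real_derivative wss t (c + s) - wss t (c - s)) (at s)"
      by (auto intro!: derivative_eq_intros DERIV_chain2[OF dss])
    show "((\<lambda>t. w t (c + s) - w t (c - s)) has_real_derivative wt t (c + s) - wt t (c - s)) (at t)"
      by (intro DERIV_diff dt)
    show "((\<lambda>t. wt t (c + s) - wt t (c - s)) has_real_derivative wtt t (c + s) - wtt t (c - s)) (at t)"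
      by (intro DERIV_diff dtt)
    show "a * (wtt t (c + s) - wtt t (c - s)) + b * (wss t (c + s) - wss t (c - s)) +
       \<kappa> * (w t (c + s) - w t (c - s)) = 0" if "0 < t" "t < T"
      using eq[OF that, of "c + s"] eq[OF that, of "c - s"] by (simp add: algebra_simps)
    show "w t (c + pi) - w t (c - pi) = 0" if "0 \<le> t" "t \<le> T"
      using per[OF that, of "c - pi"] by (simp add: algebra_simps)
  qed (use assms in auto)
  then show ?thesis by simp
qed

text \<open>Applying the previous inequality to \<open>w\<close> and to \<open>- w\<close> gives symmetry about every angle; reflecting
about \<open>s/2\<close> exchanges \<open>s\<close> and \<open>0\<close>.\<close>

lemma periodic_solution_constant_in_angle:
  fixes w wt wtt ws wss :: "real \<Rightarrow> real \<Rightarrow> real"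
  assumes "T > 0" "a > 0" "b > 0" "\<kappa> < b"
    and cont: "continuous_on UNIV (\<lambda>(t, s). w t s)"
    and dt: "\<And>t s. ((\<lambda>t. w t s) has_real_derivative wt t s) (at t)"
    and dtt: "\<And>t s. ((\<lambda>t. wt t s) has_real_derivative wtt t s) (at t)"
    and ds: "\<And>t s. ((\<lambda>s. w t s) has_real_derivative ws t s) (at s)"
    and dss: "\<And>t s. ((\<lambda>s. ws t s) has_real_derivative wss t s) (at s)"
    and eq: "\<And>t s. \<lbrakk>0 < t; t < T\<rbrakk> \<Longrightarrow> a * wtt t s + b * wss t s + \<kappa> * w t s = 0"
    and bdry: "\<And>s. w 0 s = 0" "\<And>s. w T s = 0"
    and per: "\<And>t s. \<lbrakk>0 \<le> t; t \<le> T\<rbrakk> \<Longrightarrow> w t (s + 2 * pi) = w t s"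
    and t: "0 \<le> t" "t \<le> T" and s: "0 \<le> s" "s \<le> 2 * pi"
  shows "w t s = w t 0"
proof (rule antisym)
  show "w t s \<le> w t 0"
    using periodic_solution_reflection_le[OF assms(1-13) t, of "s / 2" "s / 2"] s by simp
  have "- w t (s/2 + s/2) \<le> - w t (s/2 - s/2)"
  proof (rule periodic_solution_reflection_le[where w = "\<lambda>t s. - w t s" and wt = "\<lambda>t s. - wt t s"
        and wtt = "\<lambda>t s. - wtt t s" and ws = "\<lambda>t s. - ws t s" and wss = "\<lambda>t s. - wss t s"
        and T = T and a = a and b = b and \<kappa> = \<kappa>])
    show "continuous_on UNIV (\<lambda>(t, s). - w t s)"
      using continuous_on_minus[OF cont] by (simp add: case_prod_unfold)
    show "a * - wtt t s + b * - wss t s + \<kappa> * - w t s = 0" if "0 < t" "t < T" for t s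
      using eq[OF that, of s] by simp
  qed (use assms in \<open>auto intro!: DERIV_minus\<close>)
  then show "w t 0 \<le> w t s" by simp
qed

text \<open>With \<open>\<kappa> \<le> 0\<close> the concave positive function \<open>T\<^sup>2 + 1 - t\<^sup>2\<close> is a strict supersolution, and the
comparison argument of the rectangle applies.\<close>

lemma dirichlet_max_principle_interval:
  fixes g gt gtt :: "real \<Rightarrow> real"
  assumes "T > 0" "a > 0" "\<kappa> \<le> 0"
    and cont: "continuous_on {0..T} g"
    and gt: "\<And>t. \<lbrakk>0 < t; t < T\<rbrakk> \<Longrightarrow> (g has_real_derivative gt t) (at t)"
    and gtt: "\<And>t. \<lbrakk>0 < t; t < T\<rbrakk> \<Longrightarrow> (gt has_real_derivative gtt t) (at t)"
    and eq: "\<And>t. \<lbrakk>0 < t; t < T\<rbrakk> \<Longrightarrow> a * gtt t + \<kappa> * g t = 0"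
    and bdry: "g 0 = 0" "g T = 0" and t0: "0 \<le> t0" "t0 \<le> T"
  shows "g t0 \<le> 0"
proof (rule ccontr)
  assume pos: "\<not> g t0 \<le> 0"
  define \<phi> where "\<phi> t = T^2 + 1 - t^2" for t
  have \<phi>: "\<phi> t > 0" if "0 \<le> t" "t \<le> T" for t
  proof -
    have "t^2 \<le> T^2" using that by (intro power_mono)
    then show ?thesis unfolding \<phi>_def by linarith
  qed
  have "\<exists>p\<in>{0..T}. \<forall>q\<in>{0..T}. g q / \<phi> q \<le> g p / \<phi> p"
  proof (rule continuous_attains_sup)
    show "continuous_on {0..T} (\<lambda>q. g q / \<phi> q)"
      using less_imp_neq[OF \<phi>]
      by (intro continuous_on_divide cont) (force simp: \<phi>_def intro!: continuous_intros)+
  qed (use assms(1) in auto)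
  then obtain t where p: "0 \<le> t" "t \<le> T"
    and le: "\<And>t'. \<lbrakk>0 \<le> t'; t' \<le> T\<rbrakk> \<Longrightarrow> g t' / \<phi> t' \<le> g t / \<phi> t"
    by force
  define M where "M = g t / \<phi> t"
  have "0 < g t0 / \<phi> t0" using pos \<phi> t0 by simp
  also have "\<dots> \<le> M" unfolding M_def using le t0 by blast
  finally have M: "M > 0" .
  have gM: "g t = M * \<phi> t" using \<phi>[OF p] by (simp add: M_def)
  have gle: "g t' \<le> M * \<phi> t'" if "0 \<le> t'" "t' \<le> T" for t'
    using le[OF that] \<phi>[OF that] by (simp add: M_def field_simps)
  have gpos: "g t > 0" using gM M \<phi> p by simp
  then have int: "0 < t" "t < T"
    using p bdry by (auto simp: less_le)
  have "gtt t + M * 2 \<le> 0"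
  proof (rule second_derivative_nonpos_at_local_max[of "{0<..<T}" t "\<lambda>t. g t - M * \<phi> t" "\<lambda>t. gt t + M * (2 * t)"])
    show "((\<lambda>t. g t - M * \<phi> t) has_real_derivative gt y + M * (2 * y)) (at y)" if "y \<in> {0<..<T}" for y
      unfolding \<phi>_def using gt[of y] that by (auto intro!: derivative_eq_intros)
    show "((\<lambda>t. gt t + M * (2 * t)) has_real_derivative gtt t + M * 2) (at t)"
      using gtt[of t] int by (auto intro!: derivative_eq_intros)
  qed (use int gle gM in auto)
  then have "gtt t < 0" using M by simp
  then have "a * gtt t < 0" using assms(2) by (simp add: mult_pos_neg)
  moreover have "\<kappa> * g t \<le> 0" using assms(3) gpos by (simp add: mult_nonpos_nonneg)
  ultimately show False using eq[OF int] by simp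
qed

text \<open>The maximum principle excludes \<open>\<kappa> \<le> 0\<close>. For \<open>\<kappa> = a \<omega>\<^sup>2 > 0\<close> the two expressions \<open>g' cos \<omega>t + \<omega> g sin \<omega>t\<close>
and \<open>g' sin \<omega>t - \<omega> g cos \<omega>t\<close> are first integrals; they determine \<open>g\<close> in the open interval, and by
continuity up to its ends, where the boundary conditions fix the phase and quantize \<open>\<omega>\<close>.\<close>

lemma dirichlet_eigenfunction_interval:
  fixes g gt gtt :: "real \<Rightarrow> real"
  assumes "T > 0" "a > 0"
    and cont: "continuous_on {0..T} g"
    and gt: "\<And>t. \<lbrakk>0 < t; t < T\<rbrakk> \<Longrightarrow> (g has_real_derivative gt t) (at t)"
    and gtt: "\<And>t. \<lbrakk>0 < t; t < T\<rbrakk> \<Longrightarrow> (gt has_real_derivative gtt t) (at t)"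
    and eq: "\<And>t. \<lbrakk>0 < t; t < T\<rbrakk> \<Longrightarrow> a * gtt t + \<kappa> * g t = 0"
    and bdry: "g 0 = 0" "g T = 0" and t0: "0 \<le> t0" "t0 \<le> T" "g t0 \<noteq> 0"
  obtains k :: nat and A where "k \<ge> 1" "\<kappa> = a * (real k * pi / T)^2"
    "\<And>t. \<lbrakk>0 \<le> t; t \<le> T\<rbrakk> \<Longrightarrow> g t = A * sin (real k * pi / T * t)"
proof -
  have "\<kappa> > 0"
  proof (rule ccontr)
    assume "\<not> \<kappa> > 0"
    then have \<kappa>: "\<kappa> \<le> 0" by simp
    have "g t0 \<le> 0"
      by (rule dirichlet_max_principle_interval[OF assms(1,2) \<kappa> cont gt gtt eq bdry t0(1,2)])
    moreover have "- g t0 \<le> 0"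
    proof (rule dirichlet_max_principle_interval[where g = "\<lambda>t. - g t" and gt = "\<lambda>t. - gt t"
          and gtt = "\<lambda>t. - gtt t" and T = T and a = a and \<kappa> = \<kappa>])
      show "a * - gtt t + \<kappa> * - g t = 0" if "0 < t" "t < T" for t
        using eq[OF that] by simp
    qed (use assms \<kappa> in \<open>auto intro!: DERIV_minus continuous_on_minus\<close>)
    ultimately show False using t0(3) by simp
  qed
  define \<omega> where "\<omega> = sqrt (\<kappa> / a)"
  have \<omega>: "\<omega> > 0" and \<omega>2: "\<omega>^2 = \<kappa> / a"
    using \<open>\<kappa> > 0\<close> assms(2) by (auto simp: \<omega>_def)
  have g2eq: "gtt t = - (\<omega>^2 * g t)" if "0 < t" "t < T" for t
    using eq[OF that] assms(2) by (simp add: \<omega>2 field_simps)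
  have dsin: "((\<lambda>t. sin (\<omega> * t)) has_real_derivative \<omega> * cos (\<omega> * t)) (at t)"
    and dcos: "((\<lambda>t. cos (\<omega> * t)) has_real_derivative - (\<omega> * sin (\<omega> * t))) (at t)" for t
    by (auto intro!: derivative_eq_intros)
  let ?p = "\<lambda>t. gt t * cos (\<omega> * t) + \<omega> * g t * sin (\<omega> * t)"
  let ?q = "\<lambda>t. gt t * sin (\<omega> * t) - \<omega> * g t * cos (\<omega> * t)"
  have "\<exists>c. \<forall>t\<in>{0<..<T}. ?p t = c"
  proof (rule has_field_derivative_zero_constant)
    show "(?p has_real_derivative 0) (at t within {0<..<T})" if "t \<in> {0<..<T}" for t
    proof -
      have t: "0 < t" "t < T" using that by auto
      have "(?p has_real_derivative 0) (at t)"
        by (rule DERIV_cong[OF DERIV_add[OF DERIV_mult[OF gtt[OF t] dcos] DERIV_mult[OF DERIV_cmult[OF gt[OF t]] dsin]]])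
           (simp add: g2eq[OF t] algebra_simps power2_eq_square)
      then show ?thesis by (rule has_field_derivative_at_within)
    qed
  qed auto
  then obtain P where P: "\<And>t. 0 < t \<Longrightarrow> t < T \<Longrightarrow> ?p t = P" by auto
  have "\<exists>c. \<forall>t\<in>{0<..<T}. ?q t = c"
  proof (rule has_field_derivative_zero_constant)
    show "(?q has_real_derivative 0) (at t within {0<..<T})" if "t \<in> {0<..<T}" for t
    proof -
      have t: "0 < t" "t < T" using that by auto
      have "(?q has_real_derivative 0) (at t)"
        by (rule DERIV_cong[OF DERIV_diff[OF DERIV_mult[OF gtt[OF t] dsin] DERIV_mult[OF DERIV_cmult[OF gt[OF t]] dcos]]])
           (simp add: g2eq[OF t] algebra_simps power2_eq_square)
      then show ?thesis by (rule has_field_derivative_at_within)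
    qed
  qed auto
  then obtain Q where Q: "\<And>t. 0 < t \<Longrightarrow> t < T \<Longrightarrow> ?q t = Q" by auto
  have "g t = (P * sin (\<omega> * t) - Q * cos (\<omega> * t)) / \<omega>" if "0 < t" "t < T" for t
  proof -
    have "P * sin (\<omega> * t) - Q * cos (\<omega> * t) = \<omega> * g t * ((sin (\<omega> * t))^2 + (cos (\<omega> * t))^2)"
      unfolding P[OF that, symmetric] Q[OF that, symmetric] by algebra
    then show ?thesis using \<omega> by simp
  qed
  then have int: "g t - (P * sin (\<omega> * t) - Q * cos (\<omega> * t)) / \<omega> = 0" if "t \<in> {0<..<T}" for t
    using that by simp
  have sol: "g t = (P * sin (\<omega> * t) - Q * cos (\<omega> * t)) / \<omega>" if "0 \<le> t" "t \<le> T" for t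
  proof -
    have "g t - (P * sin (\<omega> * t) - Q * cos (\<omega> * t)) / \<omega> = 0"
    proof (rule continuous_constant_on_closure[of "{0<..<T}"
          "\<lambda>t. g t - (P * sin (\<omega> * t) - Q * cos (\<omega> * t)) / \<omega>"])
      show "continuous_on (closure {0<..<T}) (\<lambda>t. g t - (P * sin (\<omega> * t) - Q * cos (\<omega> * t)) / \<omega>)"
        using assms(1) \<omega> by (auto intro!: continuous_intros cont)
    qed (use int that assms(1) in auto)
    then show ?thesis by simp
  qed
  have "Q = 0" using sol[of 0] bdry(1) \<omega> assms(1) by simp
  then have sol': "g t = P / \<omega> * sin (\<omega> * t)" if "0 \<le> t" "t \<le> T" for t
    using sol[OF that] by simp
  then have "P \<noteq> 0" using t0 by auto
  then have "sin (\<omega> * T) = 0" using sol'[of T] bdry(2) \<omega> assms(1) by simp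
  then obtain i :: int where i: "\<omega> * T = of_int i * pi"
    unfolding sin_zero_iff_int2 by auto
  then have "of_int i * pi > 0" using \<omega> assms(1) by (metis mult_pos_pos)
  then have "i > 0" by (simp add: zero_less_mult_iff)
  define k where "k = nat i"
  have k: "k \<ge> 1" "real_of_int i = real k" using \<open>i > 0\<close> by (auto simp: k_def)
  have \<omega>k: "\<omega> = real k * pi / T" using i k assms(1) by (simp add: field_simps)
  show thesis
  proof (rule that[of k "P / \<omega>"])
    show "\<kappa> = a * (real k * pi / T)^2"
      using \<omega>2 assms(2) unfolding \<omega>k by (simp add: field_simps)
    show "g t = P / \<omega> * sin (real k * pi / T * t)" if "0 \<le> t" "t \<le> T" for t
      using sol'[OF that] unfolding \<omega>k .
  qed (rule k)
qed


section \<open>Negative eigenvalues and the index\<close>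

lemma killing_param_height: "killing_param R p $ 3 = exp (p $ 1)"
  by (simp add: killing_param_def)

lemma killing_param_cong:
  assumes "p $ 1 = q $ 1" "cos (p $ 2) = cos (q $ 2)" "sin (p $ 2) = sin (q $ 2)"
  shows "killing_param R p = killing_param R q"
  using assms by (simp add: killing_param_def)

text \<open>The piece is parametrized by one full turn only, while functions are pulled back to the whole strip;
reducing the angle modulo \<open>2\<pi>\<close> shows that the whole strip has the same image.\<close>

lemma killing_param_in_piece_iff:
  "killing_param R p \<in> killing_piece R T \<longleftrightarrow> 0 \<le> p $ 1 \<and> p $ 1 \<le> T"
proof
  assume "killing_param R p \<in> killing_piece R T"
  then obtain q where q: "q \<in> piece_domain T" "killing_param R p = killing_param R q"
    unfolding killing_piece_def by blast
  then have "p $ 1 = q $ 1" using killing_param_height by (metis exp_inj_iff)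
  with q(1) show "0 \<le> p $ 1 \<and> p $ 1 \<le> T" by (simp add: piece_domain_def)
next
  assume p: "0 \<le> p $ 1 \<and> p $ 1 \<le> T"
  obtain s where s: "0 \<le> s" "s < 2 * pi" "cos (p $ 2) = cos s" "sin (p $ 2) = sin s"
    using sincos_total_2pi[OF sin_cos_squared_add2[of "p $ 2"]] by metis
  have "killing_param R p = killing_param R (vector [p $ 1, s])"
    using s by (intro killing_param_cong) auto
  moreover have "vector [p $ 1, s] \<in> piece_domain T" using p s by (simp add: piece_domain_def)
  ultimately show "killing_param R p \<in> killing_piece R T" unfolding killing_piece_def by blast
qed

text \<open>The rotationally symmetric function with profile \<open>h\<close>, extended by \<open>0\<close>. The logarithm of the
height recovers the parameter \<open>t\<close>.\<close>

definition radial :: "real \<Rightarrow> real \<Rightarrow> (real \<Rightarrow> real) \<Rightarrow> real^3 \<Rightarrow> real" where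
  "radial R T h x = (if x \<in> killing_piece R T then h (ln (x $ 3)) else 0)"

lemma radial_killing_param:
  "radial R T h (killing_param R p) = (if 0 \<le> p $ 1 \<and> p $ 1 \<le> T then h (p $ 1) else 0)"
  by (simp add: radial_def killing_param_in_piece_iff killing_param_height)

lemma radial_dirichlet:
  assumes "smooth (\<lambda>p::real^2. h (p $ 1))" "h 0 = 0" "h T = 0"
  shows "radial R T h \<in> dirichlet_functions R T"
proof -
  have "radial R T h x = 0" if "x \<in> killing_piece_boundary R T" for x
    using that assms(2,3) by (auto simp: killing_piece_boundary_def radial_killing_param)
  moreover have "\<exists>v. smooth v \<and> (\<forall>p. 0 \<le> p $ 1 \<and> p $ 1 \<le> T \<longrightarrow> radial R T h (killing_param R p) = v p)"
    using assms(1) by (intro exI[of _ "\<lambda>p. h (p $ 1)"]) (simp add: radial_killing_param)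
  ultimately show ?thesis by (auto simp: dirichlet_functions_def radial_def)
qed

definition sine_mode :: "real \<Rightarrow> real \<Rightarrow> nat \<Rightarrow> real^3 \<Rightarrow> real" where
  "sine_mode R T k = radial R T (\<lambda>t. sin (real k * pi / T * t))"

text \<open>The value of \<open>- J\<close> on \<open>sin(k\<pi>t/T)\<close>, with the potential term \<open>1/(c\<^sup>2 r\<^sup>2)\<close> brought over the common
denominator \<open>c\<^sup>2\<close>, so that its sign can be read off.\<close>

definition mode_eigenvalue :: "real \<Rightarrow> real \<Rightarrow> nat \<Rightarrow> real" where
  "mode_eigenvalue R T k = ((real k * pi / T)^2 - 1 / (sinh R)^2) / (cosh R)^2"

lemma sin_mode_end:
  assumes "T > 0" shows "sin (real k * pi / T * T) = 0"
  using assms by (simp add: sin_zero_iff_int2)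

text \<open>The factor \<open>A\<close> is included so that the eigenspace is seen to contain the whole line spanned by the
mode.\<close>

lemma sine_mode_eigenspace:
  assumes "R > 0" "T > 0"
  shows "(\<lambda>x. A * sine_mode R T k x) \<in> eigenspace R T (mode_eigenvalue R T k)"
proof -
  define \<omega> where "\<omega> = real k * pi / T"
  define h where "h t = A * sin (\<omega> * t)" for t
  define v where "v p = h (p $ 1)" for p :: "real^2"
  have eq: "(\<lambda>x. A * sine_mode R T k x) = radial R T h"
    by (auto simp: sine_mode_def radial_def h_def \<omega>_def)
  have sm: "smooth v"
    using smooth_sin_fst[of A \<omega>] by (simp add: v_def[abs_def] h_def)
  have "radial R T h \<in> dirichlet_functions R T"
  proof (rule radial_dirichlet)
    show "smooth (\<lambda>p::real^2. h (p $ 1))" using sm unfolding v_def[abs_def] .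
    show "h 0 = 0" by (simp add: h_def)
    show "h T = 0" unfolding h_def \<omega>_def sin_mode_end[OF assms(2)] by simp
  qed
  moreover have "jacobi (killing_param R) (radial R T h \<circ> killing_param R) p +
      mode_eigenvalue R T k * radial R T h (killing_param R p) = 0" if p: "0 < p $ 1" "p $ 1 < T" for p
  proof -
    let ?U = "{q::real^2. 0 < q $ 1 \<and> q $ 1 < T}"
    have "open ?U"
      by (intro open_Collect_conj open_Collect_less continuous_intros)
    then have J: "jacobi (killing_param R) (radial R T h \<circ> killing_param R) p =
        pd 1 (pd 1 v) p / (cosh R)^2 + pd 2 (pd 2 v) p / (sinh R)^2 + v p / ((cosh R)^2 * (sinh R)^2)"
      using p smoothD(3)[OF sm] assms(1)
      by (intro jacobi_killing[of R ?U]) (auto simp: radial_killing_param v_def)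
    have v1: "pd 1 v = (\<lambda>p. A * \<omega> * cos (\<omega> * p $ 1))"
      unfolding v_def[abs_def]
      by (intro ext pd_comp_fst) (auto simp: h_def[abs_def] intro!: derivative_eq_intros)
    have v11: "pd 1 (\<lambda>p::real^2. A * \<omega> * cos (\<omega> * p $ 1)) p = - (\<omega>^2) * v p"
      by (rule pd_comp_fst)
         (auto simp: v_def h_def power2_eq_square intro!: derivative_eq_intros)
    have v2: "pd 2 v = (\<lambda>p. 0)"
      unfolding v_def[abs_def] by (intro ext pd_2_comp_fst)
    have v22: "pd 2 (\<lambda>p::real^2. 0::real) p = 0"
      using pd_2_comp_fst[of "\<lambda>_. 0"] .
    have "radial R T h (killing_param R p) = v p"
      using p by (simp add: radial_killing_param v_def)
    then show ?thesis
      unfolding J v1 v11 v2 v22 mode_eigenvalue_def \<omega>_def[symmetric]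
      by (simp add: divide_inverse algebra_simps)
  qed
  ultimately show ?thesis unfolding eq eigenspace_def by blast
qed

lemma DERIV_transform_nhds:
  assumes "(f has_real_derivative D) (at x)" "eventually (\<lambda>y. g y = f y) (nhds x)"
  shows "(g has_real_derivative D) (at x)"
  using DERIV_cong_ev[OF refl assms(2) refl] assms(1) by simp

text \<open>This is the heart of the index computation. A negative \<open>\<mu>\<close> gives
\<open>\<kappa> = 1/(c\<^sup>2 r\<^sup>2) + \<mu> < 1/r\<^sup>2\<close>, which is the hypothesis under which periodic solutions do not depend on the angle;
the remaining equation in \<open>t\<close> is solved by the one-dimensional lemma.\<close>

lemma negative_eigenfunction_is_sine_mode:
  assumes "R > 0" "T > 0" and f: "f \<in> eigenspace R T \<mu>" and "\<mu> < 0" and nz: "f x0 \<noteq> 0"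
  obtains k A where "k \<ge> 1" "\<mu> = mode_eigenvalue R T k" "f = (\<lambda>x. A * sine_mode R T k x)"
proof -
  have sc: "sinh R > 0" "cosh R > 0" using assms(1) by auto
  have f0: "f x = 0" if "x \<notin> killing_piece R T" for x
    using f that by (auto simp: eigenspace_def dirichlet_functions_def)
  have fb: "f x = 0" if "x \<in> killing_piece_boundary R T" for x
    using f that by (auto simp: eigenspace_def dirichlet_functions_def)
  obtain v where sm: "smooth v"
    and fv: "\<And>p. 0 \<le> p $ 1 \<Longrightarrow> p $ 1 \<le> T \<Longrightarrow> f (killing_param R p) = v p"
    using f by (auto simp: eigenspace_def dirichlet_functions_def)
  have pde: "jacobi (killing_param R) (f \<circ> killing_param R) p + \<mu> * f (killing_param R p) = 0"
    if "0 < p $ 1" "p $ 1 < T" for p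
    using f that by (auto simp: eigenspace_def)
  define w where "w t s = v (vector [t, s])" for t s
  define wt where "wt t s = pd 1 v (vector [t, s])" for t s
  define wtt where "wtt t s = pd 1 (pd 1 v) (vector [t, s])" for t s
  define ws where "ws t s = pd 2 v (vector [t, s])" for t s
  define wss where "wss t s = pd 2 (pd 2 v) (vector [t, s])" for t s
  define \<kappa> where "\<kappa> = 1 / ((cosh R)^2 * (sinh R)^2) + \<mu>"
  have fw: "f (killing_param R (vector [t, s])) = w t s" if "0 \<le> t" "t \<le> T" for t s
    using fv[of "vector [t, s]"] that by (simp add: w_def)
  have bd: "w t s = 0" if "t = 0 \<or> t = T" for t s
  proof -
    obtain s' where s: "0 \<le> s'" "s' < 2 * pi" "cos s = cos s'" "sin s = sin s'"
      using sincos_total_2pi[OF sin_cos_squared_add2[of s]] by metis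
    have "killing_param R (vector [t, s]) = killing_param R (vector [t, s'])"
      using s by (intro killing_param_cong) auto
    moreover have "killing_param R (vector [t, s']) \<in> killing_piece_boundary R T"
      unfolding killing_piece_boundary_def using s that assms(2)
      by (intro imageI) (auto simp: piece_domain_def)
    ultimately show ?thesis using fw[of t s] fb that assms(2) by auto
  qed
  have per: "w t (s + 2 * pi) = w t s" if "0 \<le> t" "t \<le> T" for t s
  proof -
    have "killing_param R (vector [t, s + 2 * pi]) = killing_param R (vector [t, s])"
      by (intro killing_param_cong) auto
    then show ?thesis using fw[OF that] by metis
  qed
  have eq: "1 / (cosh R)^2 * wtt t s + 1 / (sinh R)^2 * wss t s + \<kappa> * w t s = 0"
    if "0 < t" "t < T" for t s
  proof -
    let ?U = "{q::real^2. 0 < q $ 1 \<and> q $ 1 < T}" and ?p = "vector [t, s] :: real^2"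
    have "open ?U"
      by (intro open_Collect_conj open_Collect_less continuous_intros)
    then have "jacobi (killing_param R) (f \<circ> killing_param R) ?p =
        pd 1 (pd 1 v) ?p / (cosh R)^2 + pd 2 (pd 2 v) ?p / (sinh R)^2 + v ?p / ((cosh R)^2 * (sinh R)^2)"
      using that smoothD(3)[OF sm] assms(1)
      by (intro jacobi_killing[of R ?U]) (auto simp: fv)
    then show ?thesis using pde[of ?p] that fw[of t s]
      by (simp add: wtt_def wss_def w_def \<kappa>_def algebra_simps)
  qed
  have "\<kappa> < 1 / (sinh R)^2"
  proof -
    have "(cosh R)^2 > 1" using assms(1) by (simp add: cosh_square_eq)
    then have "1 / ((cosh R)^2 * (sinh R)^2) < 1 / (sinh R)^2"
      using sc by (simp add: divide_simps)
    then show ?thesis using assms(4) by (simp add: \<kappa>_def)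
  qed
  have cont: "continuous_on UNIV (\<lambda>(t, s). w t s)"
  proof -
    have eq: "(\<lambda>(t, s). w t s) = (\<lambda>q. v (fst q *\<^sub>R axis 1 1 + snd q *\<^sub>R axis 2 1))"
      unfolding w_def by (auto simp: fun_eq_iff vec_eq_iff forall_2 axis_def intro!: arg_cong[of _ _ v])
    show ?thesis unfolding eq
      by (intro continuous_on_compose2[OF smoothD(1)[OF sm]] continuous_intros) auto
  qed
  have d: "((\<lambda>t. w t s) has_real_derivative wt t s) (at t)"
    "((\<lambda>t. wt t s) has_real_derivative wtt t s) (at t)"
    "((\<lambda>s. w t s) has_real_derivative ws t s) (at s)"
    "((\<lambda>s. ws t s) has_real_derivative wss t s) (at s)" for t s
    unfolding w_def wt_def wtt_def ws_def wss_def
    by (intro has_derivative_pd_1 has_derivative_pd_2 smoothD[OF sm])+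
  have indep: "w t s = w t 0" if "0 \<le> t" "t \<le> T" "0 \<le> s" "s \<le> 2 * pi" for t s
    by (rule periodic_solution_constant_in_angle[where w = w and wt = wt and wtt = wtt and ws = ws
        and wss = wss and a = "1 / (cosh R)^2" and b = "1 / (sinh R)^2" and \<kappa> = \<kappa> and T = T])
       (use assms(2) sc \<open>\<kappa> < 1 / (sinh R)^2\<close> cont d eq bd per that in auto)
  \<comment> \<open>The angle \<open>1\<close> is an arbitrary interior point of \<open>[0, 2\<pi>]\<close>; at \<open>0\<close> independence of the angle is known on one side only.\<close>
  have wss0: "wss t 1 = 0" if "0 < t" "t < T" for t
  proof -
    have "ws t s = 0" if s: "s \<in> {0<..<2 * pi}" for s
    proof -
      have "eventually (\<lambda>s. s \<in> {0<..<2 * pi}) (nhds s)"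
        by (rule eventually_nhds_in_open[OF open_greaterThanLessThan s])
      then have "eventually (\<lambda>s. w t s = w t 0) (nhds s)"
        by eventually_elim (use \<open>0 < t\<close> \<open>t < T\<close> in \<open>auto intro!: indep\<close>)
      with DERIV_const have "((\<lambda>s. w t s) has_real_derivative 0) (at s)"
        by (rule DERIV_transform_nhds)
      with d(3) show ?thesis by (rule DERIV_unique)
    qed
    moreover have "eventually (\<lambda>s. s \<in> {0<..<2 * pi}) (nhds 1)"
      by (rule eventually_nhds_in_open[OF open_greaterThanLessThan]) (use pi_gt3 in simp)
    ultimately have "eventually (\<lambda>s. ws t s = 0) (nhds 1)"
      by (auto elim: eventually_mono)
    with DERIV_const have "((\<lambda>s. ws t s) has_real_derivative 0) (at 1)"
      by (rule DERIV_transform_nhds)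
    with d(4) show ?thesis by (rule DERIV_unique)
  qed
  have fx: "\<exists>t s. 0 \<le> t \<and> t \<le> T \<and> x = killing_param R (vector [t, s]) \<and> f x = w t 1"
    if "x \<in> killing_piece R T" for x
  proof -
    from that obtain p where p: "p \<in> piece_domain T" "x = killing_param R p"
      unfolding killing_piece_def by blast
    have "p = vector [p $ 1, p $ 2]" by (simp add: vec_eq_iff forall_2)
    moreover have "w (p $ 1) (p $ 2) = w (p $ 1) 1"
      using indep[of "p $ 1" "p $ 2"] indep[of "p $ 1" 1] p(1) pi_gt3 by (simp add: piece_domain_def)
    moreover have "f x = w (p $ 1) (p $ 2)"
      using fw[of "p $ 1" "p $ 2"] p calculation(1) by (simp add: piece_domain_def)
    ultimately show ?thesis using p by (intro exI[of _ "p $ 1"] exI[of _ "p $ 2"]) (simp add: piece_domain_def)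
  qed
  obtain t0 where t0: "0 \<le> t0" "t0 \<le> T" "w t0 1 \<noteq> 0"
    using fx[of x0] nz f0[of x0] by metis
  have cg: "continuous_on {0..T} (\<lambda>t. w t 1)"
    by (intro DERIV_continuous_on) (auto intro: has_field_derivative_at_within d)
  obtain k A where k: "k \<ge> 1" "\<kappa> = 1 / (cosh R)^2 * (real k * pi / T)^2"
    and A: "\<And>t. \<lbrakk>0 \<le> t; t \<le> T\<rbrakk> \<Longrightarrow> w t 1 = A * sin (real k * pi / T * t)"
  proof (rule dirichlet_eigenfunction_interval[where g = "\<lambda>t. w t 1" and gt = "\<lambda>t. wt t 1"
        and gtt = "\<lambda>t. wtt t 1" and T = T and a = "1 / (cosh R)^2" and \<kappa> = \<kappa>])
    show "1 / (cosh R)^2 * wtt t 1 + \<kappa> * w t 1 = 0" if "0 < t" "t < T" for t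
      using eq[OF that, of 1] wss0[OF that] by simp
  qed (use assms(2) sc t0 cg d bd in auto)
  have "f = (\<lambda>x. A * sine_mode R T k x)"
  proof
    fix x
    show "f x = A * sine_mode R T k x"
    proof (cases "x \<in> killing_piece R T")
      case True
      then obtain t s where "0 \<le> t" "t \<le> T" "x = killing_param R (vector [t, s])" "f x = w t 1"
        using fx by blast
      then show ?thesis using A by (simp add: sine_mode_def radial_killing_param)
    qed (simp add: f0 sine_mode_def radial_def)
  qed
  moreover have "\<mu> = mode_eigenvalue R T k"
    using k(2) sc by (simp add: \<kappa>_def mode_eigenvalue_def field_simps)
  ultimately show thesis using that k(1) by blast
qed

lemma sine_mode_nonzero:
  assumes "T > 0" "k \<ge> 1"
  shows "\<exists>x. sine_mode R T k x \<noteq> 0"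
proof -
  let ?t = "T / (2 * real k)"
  have "0 \<le> ?t" "?t \<le> T" using assms by (auto simp: field_simps)
  then have "sine_mode R T k (killing_param R (vector [?t, 0])) = sin (real k * pi / T * ?t)"
    by (simp add: sine_mode_def radial_killing_param)
  also have "real k * pi / T * ?t = pi / 2" using assms by (simp add: field_simps)
  finally show ?thesis by (intro exI[of _ "killing_param R (vector [?t, 0])"]) simp
qed

lemma mode_eigenvalue_inj:
  assumes "T > 0" shows "inj (mode_eigenvalue R T)"
proof (rule injI)
  fix k l assume "mode_eigenvalue R T k = mode_eigenvalue R T l"
  then have "(real k * pi / T)^2 = (real l * pi / T)^2" by (simp add: mode_eigenvalue_def)
  then have "real k * pi / T = real l * pi / T" using assms by (subst (asm) power2_eq_iff_nonneg) auto
  then show "k = l" using assms by simp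
qed

lemma mode_eigenvalue_negative_iff:
  assumes "R > 0" "T > 0"
  shows "mode_eigenvalue R T k < 0 \<longleftrightarrow> real k < T / (pi * sinh R)"
proof -
  have s: "sinh R > 0" "cosh R > 0" using assms(1) by auto
  have "mode_eigenvalue R T k < 0 \<longleftrightarrow> (real k * pi / T)^2 < (1 / sinh R)^2"
    using s by (simp add: mode_eigenvalue_def divide_less_0_iff power_one_over)
  also have "\<dots> \<longleftrightarrow> real k * pi / T < 1 / sinh R"
    using power_mono_iff[of "1 / sinh R" "real k * pi / T" 2] s assms(2)
    by (simp only: not_le[symmetric]) simp
  also have "\<dots> \<longleftrightarrow> real k < T / (pi * sinh R)"
    using s assms(2) by (simp add: field_simps)
  finally show ?thesis .
qed

text \<open>The set whose maximum defines \<open>eta\<close> is finite and an initial segment of the natural numbers.\<close>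

lemma le_eta_iff:
  assumes "R > 0" "T > 0"
  shows "k \<le> eta R T \<longleftrightarrow> real k < T / (pi * sinh R)"
proof -
  let ?S = "{m::nat. real m < T / (pi * sinh R)}"
  have "T / (pi * sinh R) > 0" using assms by simp
  then have "0 \<in> ?S" by simp
  moreover have fin: "finite ?S"
  proof (rule finite_subset)
    show "?S \<subseteq> {..nat \<lceil>T / (pi * sinh R)\<rceil>}" by (auto simp: le_nat_iff) linarith
  qed simp
  ultimately have "eta R T \<in> ?S" unfolding eta_def by (intro Max_in) blast+
  then show ?thesis using Max_ge[OF fin, of k] by (auto simp: eta_def)
qed

lemma negative_eigenvalues_eq:
  assumes "R > 0" "T > 0"
  shows "negative_eigenvalues R T = mode_eigenvalue R T ` {1..eta R T}"
proof (intro equalityI subsetI)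
  fix \<mu> assume "\<mu> \<in> negative_eigenvalues R T"
  then obtain f x where "\<mu> < 0" "f \<in> eigenspace R T \<mu>" "f x \<noteq> 0"
    unfolding negative_eigenvalues_def by blast
  with negative_eigenfunction_is_sine_mode[OF assms] obtain k
    where "k \<ge> 1" "\<mu> = mode_eigenvalue R T k" by metis
  with \<open>\<mu> < 0\<close> show "\<mu> \<in> mode_eigenvalue R T ` {1..eta R T}"
    using assms by (auto simp: mode_eigenvalue_negative_iff le_eta_iff)
next
  fix \<mu> assume "\<mu> \<in> mode_eigenvalue R T ` {1..eta R T}"
  then obtain k where k: "k \<ge> 1" "k \<le> eta R T" "\<mu> = mode_eigenvalue R T k" by auto
  then have "\<mu> < 0" using assms by (simp add: mode_eigenvalue_negative_iff le_eta_iff)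
  moreover have "sine_mode R T k \<in> eigenspace R T \<mu>"
    using sine_mode_eigenspace[OF assms, of 1 k] k(3) by simp
  ultimately show "\<mu> \<in> negative_eigenvalues R T"
    using sine_mode_nonzero[OF assms(2) k(1)] unfolding negative_eigenvalues_def by blast
qed

lemma edim_eigenspace:
  assumes "R > 0" "T > 0" "1 \<le> k" "k \<le> eta R T"
  shows "edim (eigenspace R T (mode_eigenvalue R T k)) = 1"
proof -
  let ?b = "sine_mode R T k"
  have neg: "mode_eigenvalue R T k < 0"
    using assms by (simp add: mode_eigenvalue_negative_iff le_eta_iff)
  have "f \<in> range (\<lambda>A x. A * ?b x)" if f: "f \<in> eigenspace R T (mode_eigenvalue R T k)" for f
  proof (cases "\<exists>x. f x \<noteq> 0")
    case True
    then obtain l A where "mode_eigenvalue R T k = mode_eigenvalue R T l" "f = (\<lambda>x. A * sine_mode R T l x)"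
      using negative_eigenfunction_is_sine_mode[OF assms(1,2) f neg] by metis
    then show ?thesis using mode_eigenvalue_inj[OF assms(2)] by (auto dest: injD)
  next
    case False
    then have "f = (\<lambda>x. 0 * ?b x)" by auto
    then show ?thesis by blast
  qed
  then have eq: "eigenspace R T (mode_eigenvalue R T k) = fun_vs.span {?b}"
    using sine_mode_eigenspace[OF assms(1,2)] unfolding fun_vs.span_singleton by blast
  obtain x where "?b x \<noteq> 0" using sine_mode_nonzero[OF assms(2,3)] by blast
  then have "?b \<noteq> 0" by (auto simp: zero_fun_def)
  then have "fun_vs.dim (fun_vs.span {?b}) = 1"
    by (subst fun_vs.dim_span_eq_card_independent) auto
  then show ?thesis
    unfolding edim_def eq by (auto simp: one_enat_def intro!: exI[of _ "{?b}"])
qed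

lemma morse_index_eq_eta:
  assumes "R > 0" "T > 0"
  shows "morse_index R T = enat (eta R T)"
proof -
  have "morse_index R T = (\<Sum>\<mu>\<in>mode_eigenvalue R T ` {1..eta R T}. edim (eigenspace R T \<mu>))"
    by (simp add: morse_index_def negative_eigenvalues_eq[OF assms])
  also have "\<dots> = (\<Sum>k\<in>{1..eta R T}. edim (eigenspace R T (mode_eigenvalue R T k)))"
    by (rule sum.reindex[unfolded o_def]) (rule inj_on_subset[OF mode_eigenvalue_inj[OF assms(2)] subset_UNIV])
  also have "\<dots> = (\<Sum>k\<in>{1..eta R T}. 1)"
    by (intro sum.cong refl edim_eigenspace assms) auto
  also have "\<dots> = enat (eta R T)" by (simp add: of_nat_eq_enat)
  finally show ?thesis .
qed


section \<open>The quadratic form on functions of the length parameter\<close>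

lemma measurable_vec2: "(\<lambda>(x, y). vector [x, y] :: real^2) \<in> lborel \<Otimes>\<^sub>M lborel \<rightarrow>\<^sub>M borel"
proof -
  have eq: "(\<lambda>(x, y). vector [x, y] :: real^2) = (\<lambda>q. fst q *\<^sub>R axis 1 1 + snd q *\<^sub>R axis 2 1)"
    by (auto simp: fun_eq_iff vec_eq_iff forall_2 axis_def)
  have "(\<lambda>q. fst q *\<^sub>R axis 1 1 + snd q *\<^sub>R axis 2 1 :: real^2) \<in> borel_measurable borel"
    by (intro borel_measurable_continuous_onI continuous_intros)
  then show ?thesis unfolding eq lborel_prod by simp
qed

text \<open>Fubini's theorem concerns product measures; this identification transports it to the parameter
plane.\<close>

lemma lborel_vec2: "lborel = distr (lborel \<Otimes>\<^sub>M lborel) borel (\<lambda>(x, y). vector [x, y] :: real^2)"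
proof (rule lborel_eqI)
  have B: "(Basis :: (real^2) set) = {axis 1 1, axis 2 1}"
    by (auto simp: Basis_vec_def UNIV_2)
  note measurable_vec2[measurable]
  fix l u :: "real^2" assume le: "\<And>b. b \<in> Basis \<Longrightarrow> l \<bullet> b \<le> u \<bullet> b"
  have l1: "l $ 1 \<le> u $ 1" "l $ 2 \<le> u $ 2"
    using le[of "axis 1 1"] le[of "axis 2 1"] by (auto simp: B inner_axis)
  have pre: "(\<lambda>(x, y). vector [x, y] :: real^2) -` box l u = {l $ 1<..<u $ 1} \<times> {l $ 2<..<u $ 2}"
    by (auto simp: box_def B inner_axis)
  have "emeasure (distr (lborel \<Otimes>\<^sub>M lborel) borel (\<lambda>(x, y). vector [x, y] :: real^2)) (box l u)
      = emeasure (lborel \<Otimes>\<^sub>M lborel) ({l $ 1<..<u $ 1} \<times> {l $ 2<..<u $ 2})"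
    by (subst emeasure_distr) (simp_all add: pre space_pair_measure)
  also have "\<dots> = ennreal (u $ 1 - l $ 1) * ennreal (u $ 2 - l $ 2)"
    using l1 by (subst lborel.emeasure_pair_measure_Times) auto
  also have "\<dots> = (\<Prod>b\<in>Basis. (u - l) \<bullet> b)"
    using l1 by (simp add: B inner_axis axis_eq_axis ennreal_mult)
  finally show "emeasure (distr (lborel \<Otimes>\<^sub>M lborel) borel (\<lambda>(x, y). vector [x, y] :: real^2)) (box l u)
      = (\<Prod>b\<in>Basis. (u - l) \<bullet> b)" .
qed simp

lemma lebesgue_integral_prod_vec2:
  fixes F G :: "real \<Rightarrow> real"
  assumes "integrable lborel F" "integrable lborel G"
  shows "(LINT p|lebesgue. F (p $ (1::2)) * G (p $ 2)) = (LINT x|lborel. F x) * (LINT y|lborel. G y)"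
proof -
  have [measurable]: "F \<in> borel_measurable borel" "G \<in> borel_measurable borel"
    using assms by auto
  have [measurable]: "(\<lambda>p::real^2. p $ i) \<in> borel_measurable borel" for i
    by (intro borel_measurable_continuous_onI continuous_intros)
  note measurable_vec2[measurable]
  have "(LINT p|lebesgue. F (p $ (1::2)) * G (p $ 2)) = (LINT p|lborel. F (p $ (1::2)) * G (p $ 2))"
    by (rule integral_completion) simp
  also have "\<dots> = (LINT q|(lborel \<Otimes>\<^sub>M lborel). F (fst q) * G (snd q))"
    by (subst lborel_vec2, subst integral_distr) (auto simp: case_prod_unfold)
  also have "\<dots> = (LINT x|lborel. LINT y|lborel. F (fst (x, y)) * G (snd (x, y)))"
  proof (rule lborel_pair.integral_fst'[symmetric])
    show "integrable (lborel \<Otimes>\<^sub>M lborel) (\<lambda>q. F (fst q) * G (snd q))"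
      using assms by (intro lborel_pair.Fubini_integrable) (auto simp: abs_mult)
  qed
  also have "\<dots> = (LINT x|lborel. F x) * (LINT y|lborel. G y)" by simp
  finally show ?thesis .
qed

text \<open>The integrand \<open>H\<close> is prescribed only in the open interval: the pull-back of a function extended by
\<open>0\<close> need not be differentiable where \<open>t\<close> is \<open>0\<close> or \<open>T\<close>, and there its partial derivative may be an unspecified number.
Two exceptional values do not affect the integral.\<close>

lemma piece_domain_integral_fst:
  assumes "T > 0" and cont: "continuous_on {0..T} h" and H: "\<And>t. \<lbrakk>0 < t; t < T\<rbrakk> \<Longrightarrow> H t = h t"
  shows "(LINT p:piece_domain T|lebesgue. H (p $ 1)) = 2 * pi * integral {0..T} h"
proof -
  define F where "F t = indicator {0..T} t * H t" for t
  \<comment> \<open>Writing the integrand as a continuous part plus corrections at the two end points makes its measurability evident.\<close>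
  define F' where "F' t = indicator {0..T} t *\<^sub>R h t + ((H 0 - h 0) * indicator {0} t + (H T - h T) * indicator {T} t)" for t
  have hint: "set_integrable lborel {0..T} h"
    by (rule borel_integrable_atLeastAtMost') (rule cont)
  have "F t = F' t" for t
    using assms(1) H[of t] by (auto simp: F_def F'_def indicator_def)
  then have FF: "F = F'" by blast
  have int: "integrable lborel F" 
    unfolding FF F'_def[abs_def] using hint
    by (intro Bochner_Integration.integrable_add) (auto simp: set_integrable_def)
  have "(LINT t|lborel. F t) = integral {0..T} h"
  proof -
    have "(LINT t|lborel. F t) = (LINT t:{0..T}|lborel. h t)"
      unfolding FF F'_def[abs_def] set_lebesgue_integral_def using hint
      by (subst Bochner_Integration.integral_add) (auto simp: set_integrable_def)
    then show ?thesis using set_borel_integral_eq_integral(2)[OF hint] by simp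
  qed
  moreover have "(LINT p:piece_domain T|lebesgue. H (p $ 1)) =
      (LINT p|lebesgue. F (p $ (1::2)) * indicator {0..2 * pi} (p $ 2))"
    unfolding set_lebesgue_integral_def
    by (rule Bochner_Integration.integral_cong) (auto simp: F_def piece_domain_def indicator_def)
  ultimately show ?thesis
    using lebesgue_integral_prod_vec2[OF int, of "indicator {0..2 * pi}"] by simp
qed

lemma surf_integral_fst:
  assumes "R > 0" "T > 0" "continuous_on {0..T} w"
  shows "surf_integral (killing_param R) (piece_domain T) (\<lambda>p. w (p $ 1)) =
    2 * pi * integral {0..T} (\<lambda>t. w t * (cosh R * sinh R))"
  unfolding surf_integral_def area_density_killing[OF assms(1)]
  using piece_domain_integral_fst[OF assms(2), of "\<lambda>t. w t * (cosh R * sinh R)" "\<lambda>t. w t * (cosh R * sinh R)"]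
    assms(3) by (simp add: continuous_on_mult_right)

text \<open>At \<open>0\<close> and \<open>T\<close> the profile \<open>w\<close> may have a kink, coming from an extension by \<open>0\<close>; on the right-hand
side stands the continuous continuation \<open>w'\<close> of its derivative.\<close>

lemma jacobi_form_fst:
  assumes "R > 0" "T > 0" and cont: "continuous_on {0..T} w" "continuous_on {0..T} w'"
    and d: "\<And>t. \<lbrakk>0 < t; t < T\<rbrakk> \<Longrightarrow> (w has_real_derivative w' t) (at t)"
  shows "jacobi_form (killing_param R) (piece_domain T) (\<lambda>p. w (p $ 1)) =
    2 * pi * integral {0..T} (\<lambda>t. ((w' t)^2 / (cosh R)^2 - (w t)^2 / ((cosh R)^2 * (sinh R)^2)) * (cosh R * sinh R))"
proof -
  have sc: "sinh R \<noteq> 0" "cosh R \<noteq> 0" using assms(1) by auto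
  define D where "D t = vector_derivative (\<lambda>s. w (t + s)) (at 0)" for t
  have D: "D t = w' t" if "0 < t" "t < T" for t
    unfolding D_def using d[OF that] DERIV_shift[of w "w' t" 0 t]
    by (intro vector_derivative_at) (simp add: has_real_derivative_iff_has_vector_derivative add.commute)
  have pd1: "pd 1 (\<lambda>p. w (p $ 1)) p = D (p $ 1)" for p :: "real^2"
    unfolding pd_def D_def by (simp add: axis_def)
  let ?H = "\<lambda>d u. (d^2 / (cosh R)^2 - u^2 / ((cosh R)^2 * (sinh R)^2)) * (cosh R * sinh R)"
  have "jacobi_form (killing_param R) (piece_domain T) (\<lambda>p. w (p $ 1)) =
      (LINT p:piece_domain T|lebesgue. ?H (D (p $ 1)) (w (p $ 1)))"
    unfolding jacobi_form_def surf_integral_def area_density_killing[OF assms(1)]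
      second_ff_norm2_killing[OF assms(1)] grad_norm2_def inv_ff_killing[OF assms(1)]
    by (simp add: sum_2 pd1 pd_2_comp_fst power2_eq_square)
  also have "\<dots> = 2 * pi * integral {0..T} (\<lambda>t. ?H (w' t) (w t))"
    by (rule piece_domain_integral_fst[where H = "\<lambda>t. ?H (D t) (w t)"])
       (use assms(2) D sc in \<open>auto intro!: continuous_intros cont\<close>)
  finally show ?thesis .
qed

lemma sine_mode_comp_killing:
  "sine_mode R T k \<circ> killing_param R =
     (\<lambda>p. (\<lambda>t. if 0 \<le> t \<and> t \<le> T then sin (real k * pi / T * t) else 0) (p $ 1))"
  by (auto simp: sine_mode_def radial_killing_param fun_eq_iff)

text \<open>Integrating by parts, the form of an eigenfunction is its eigenvalue times its square norm. For a
single sine an explicit antiderivative shows this directly: its linear part has half the eigenvalue as coefficient, up to the area factor, and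
its oscillating part vanishes at both ends.\<close>

lemma sine_mode_jacobi_form_negative:
  assumes "R > 0" "T > 0" "k \<ge> 1" "mode_eigenvalue R T k < 0"
  shows "jacobi_form (killing_param R) (piece_domain T) (sine_mode R T k \<circ> killing_param R) < 0"
proof -
  have sc: "sinh R > 0" "cosh R > 0" using assms(1) by auto
  define \<omega> where "\<omega> = real k * pi / T"
  have \<omega>: "\<omega> > 0" using assms by (simp add: \<omega>_def)
  define w where "w t = (if 0 \<le> t \<and> t \<le> T then sin (\<omega> * t) else 0)" for t
  define a where "a = \<omega>^2 / (cosh R)^2"
  define b where "b = 1 / ((cosh R)^2 * (sinh R)^2)"
  have cw: "continuous_on {0..T} w"
    by (subst continuous_on_cong[OF refl, of _ _ "\<lambda>t. sin (\<omega> * t)"])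
       (auto simp: w_def intro!: continuous_intros)
  have dw: "(w has_real_derivative \<omega> * cos (\<omega> * t)) (at t)" if "0 < t" "t < T" for t
  proof (rule DERIV_transform_nhds)
    show "((\<lambda>t. sin (\<omega> * t)) has_real_derivative \<omega> * cos (\<omega> * t)) (at t)"
      by (auto intro!: derivative_eq_intros)
    have "eventually (\<lambda>y. y \<in> {0<..<T}) (nhds t)"
      by (rule eventually_nhds_in_open[OF open_greaterThanLessThan]) (use that in simp)
    then show "eventually (\<lambda>y. w y = sin (\<omega> * y)) (nhds t)"
      by eventually_elim (auto simp: w_def)
  qed
  let ?F = "\<lambda>t. ((\<omega> * cos (\<omega> * t))^2 / (cosh R)^2 - (w t)^2 / ((cosh R)^2 * (sinh R)^2)) * (cosh R * sinh R)"
  let ?G = "\<lambda>t. ((a - b) * (t / 2) + (a + b) * (sin (\<omega> * t) * cos (\<omega> * t) / (2 * \<omega>))) * (cosh R * sinh R)"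
  have "(?F has_integral ?G T - ?G 0) {0..T}"
  proof (rule fundamental_theorem_of_calculus)
    fix t assume t: "t \<in> {0..T}"
    let ?s = "sin (\<omega> * t)" and ?c = "cos (\<omega> * t)"
    have d: "((\<lambda>t. sin (\<omega> * t) * cos (\<omega> * t) / (2 * \<omega>)) has_real_derivative (?c^2 - ?s^2) / 2) (at t)"
      using \<omega> by (auto intro!: derivative_eq_intros simp: field_simps power2_eq_square)
    have "(?G has_real_derivative ((a - b) * (1 / 2) + (a + b) * ((?c^2 - ?s^2) / 2)) * (cosh R * sinh R)) (at t)"
      by (intro DERIV_cmult_right DERIV_add DERIV_cmult d DERIV_cdivide DERIV_ident)
    also have "(a - b) * (1 / 2) + (a + b) * ((?c^2 - ?s^2) / 2) = a * ?c^2 - b * ?s^2"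
      unfolding cos_squared_eq by (simp add: field_simps)
    also have "\<dots> = (\<omega> * ?c)^2 / (cosh R)^2 - (w t)^2 / ((cosh R)^2 * (sinh R)^2)"
      using t by (simp add: a_def b_def w_def power_mult_distrib)
    finally show "(?G has_vector_derivative ?F t) (at t within {0..T})"
      by (simp add: has_real_derivative_iff_has_vector_derivative[symmetric] has_field_derivative_at_within)
  qed (use assms(2) in simp)
  then have "integral {0..T} ?F = ?G T - ?G 0" by (rule integral_unique)
  moreover have "sin (\<omega> * T) = 0" unfolding \<omega>_def by (rule sin_mode_end[OF assms(2)])
  ultimately have "integral {0..T} ?F = (a - b) * (T / 2) * (cosh R * sinh R)" by simp
  moreover have "a - b < 0"
    using assms(4) unfolding mode_eigenvalue_def \<omega>_def[symmetric]
    by (simp add: a_def b_def diff_divide_distrib mult.commute)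
  ultimately have neg: "integral {0..T} ?F < 0"
    using assms(2) sc by (simp only:) (intro mult_neg_pos mult_pos_pos, auto)
  have "jacobi_form (killing_param R) (piece_domain T) (\<lambda>p. w (p $ 1)) = 2 * pi * integral {0..T} ?F"
    by (rule jacobi_form_fst[OF assms(1,2) cw _ dw]) (auto intro!: continuous_intros)
  also have "\<dots> < 0" using neg by (intro mult_pos_neg) auto
  also have "(\<lambda>p. w (p $ 1)) = sine_mode R T k \<circ> killing_param R"
    unfolding sine_mode_comp_killing w_def \<omega>_def ..
  finally show ?thesis .
qed

lemma sine_mode_2_mean_zero:
  assumes "R > 0" "T > 0"
  shows "surf_integral (killing_param R) (piece_domain T) (sine_mode R T 2 \<circ> killing_param R) = 0"
proof -
  define \<omega> where "\<omega> = real 2 * pi / T"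
  have \<omega>: "\<omega> \<noteq> 0" "\<omega> * T = 2 * pi" using assms by (auto simp: \<omega>_def)
  define w where "w t = (if 0 \<le> t \<and> t \<le> T then sin (\<omega> * t) else 0)" for t
  have cw: "continuous_on {0..T} w"
    by (subst continuous_on_cong[OF refl, of _ _ "\<lambda>t. sin (\<omega> * t)"])
       (auto simp: w_def intro!: continuous_intros)
  let ?G = "\<lambda>t. - (cos (\<omega> * t) / \<omega>) * (cosh R * sinh R)"
  have "((\<lambda>t. w t * (cosh R * sinh R)) has_integral ?G T - ?G 0) {0..T}"
  proof (rule fundamental_theorem_of_calculus)
    fix t assume t: "t \<in> {0..T}"
    have "(?G has_real_derivative w t * (cosh R * sinh R)) (at t)"
      using t \<omega>(1) by (auto intro!: derivative_eq_intros simp: w_def)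
    then show "(?G has_vector_derivative w t * (cosh R * sinh R)) (at t within {0..T})"
      by (simp add: has_real_derivative_iff_has_vector_derivative[symmetric] has_field_derivative_at_within)
  qed (use assms(2) in simp)
  then have "integral {0..T} (\<lambda>t. w t * (cosh R * sinh R)) = ?G T - ?G 0"
    by (rule integral_unique)
  also have "\<dots> = 0" by (simp add: \<omega>)
  finally have "surf_integral (killing_param R) (piece_domain T) (\<lambda>p. w (p $ 1)) = 0"
    by (simp only: surf_integral_fst[OF assms cw])
  also have "(\<lambda>p. w (p $ 1)) = sine_mode R T 2 \<circ> killing_param R"
    unfolding sine_mode_comp_killing w_def \<omega>_def ..
  finally show ?thesis .
qed

lemma sine_mode_dirichlet:
  assumes "R > 0" "T > 0"
  shows "sine_mode R T k \<in> dirichlet_functions R T"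
  using sine_mode_eigenspace[OF assms, of 1 k] by (simp add: eigenspace_def)


section \<open>A smooth mean-zero function with compact support\<close>

text \<open>These are the functions that arise by differentiating \<open>e\<^bsup>-1/x\<^esup>\<close>, continued by \<open>0\<close> to the left; the
polynomial is taken in \<open>1/x\<close>.\<close>

definition flat_exp :: "real poly \<Rightarrow> real \<Rightarrow> real" where
  "flat_exp P x = (if x \<le> 0 then 0 else poly P (1 / x) * exp (- (1 / x)))"

text \<open>A set of functions that contains bump functions supported in \<open>[0, 1]\<close> and is closed under
differentiation. Both a left and a right flat end are needed, together with products, and the product rule
then asks for sums.\<close>

inductive_set bump_algebra :: "(real \<Rightarrow> real) set" where
  left: "(\<lambda>x. flat_exp P x) \<in> bump_algebra"
| right: "(\<lambda>x. flat_exp P (1 - x)) \<in> bump_algebra"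
| add: "f \<in> bump_algebra \<Longrightarrow> g \<in> bump_algebra \<Longrightarrow> (\<lambda>x. f x + g x) \<in> bump_algebra"
| mult: "f \<in> bump_algebra \<Longrightarrow> g \<in> bump_algebra \<Longrightarrow> (\<lambda>x. f x * g x) \<in> bump_algebra"

lemma poly_exp_tendsto_0: "((\<lambda>y. poly P y * exp (- y)) \<longlongrightarrow> 0) at_top" for P :: "real poly"
proof -
  have "((\<lambda>y. \<Sum>i\<le>degree P. coeff P i * (y ^ i / exp y)) \<longlongrightarrow> (\<Sum>i\<le>degree P. coeff P i * 0)) at_top"
    by (intro tendsto_intros tendsto_power_div_exp_0)
  then show ?thesis
    by (simp add: poly_altdef sum_divide_distrib exp_minus divide_inverse[symmetric])
qed

text \<open>The only delicate point is \<open>x = 0\<close>: the difference quotient there is again a polynomial in \<open>1/h\<close>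
times \<open>e\<^bsup>-1/h\<^esup>\<close> and tends to \<open>0\<close>.\<close>

lemma has_derivative_flat_exp:
  "(flat_exp P has_real_derivative flat_exp (monom 1 2 * (P - pderiv P)) x) (at x)"
proof (cases "x = 0")
  case True
  have "(\<lambda>h. flat_exp P h / h) \<midarrow>0\<rightarrow> 0"
  proof (rule filterlim_split_at)
    show "((\<lambda>h. flat_exp P h / h) \<longlongrightarrow> 0) (at_left 0)"
      by (rule tendsto_eventually) (auto simp: eventually_at_filter flat_exp_def)
    have "((\<lambda>h. poly (pCons 0 P) (inverse h) * exp (- inverse h)) \<longlongrightarrow> 0) (at_right 0)"
      by (rule filterlim_compose[OF poly_exp_tendsto_0 filterlim_inverse_at_top_right])
    then show "((\<lambda>h. flat_exp P h / h) \<longlongrightarrow> 0) (at_right 0)"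
      by (rule Lim_transform_eventually) (auto simp: eventually_at_filter field_simps flat_exp_def)
  qed
  then show ?thesis unfolding True by (simp add: DERIV_def) (simp add: flat_exp_def)
next
  case False
  show ?thesis
  proof (cases "x < 0")
    case True
    have "((\<lambda>x. 0) has_real_derivative flat_exp (monom 1 2 * (P - pderiv P)) x) (at x)"
      using True by (simp add: flat_exp_def)
    moreover have "eventually (\<lambda>y. flat_exp P y = 0) (nhds x)"
      using True eventually_nhds_in_open[of "{..<0}" x]
      by (auto simp: flat_exp_def elim!: eventually_mono)
    ultimately show ?thesis by (rule DERIV_transform_nhds)
  next
    case False
    with \<open>x \<noteq> 0\<close> have x: "x > 0" by simp
    have "((\<lambda>x. 1 / x) has_real_derivative - ((1 / x)^2)) (at x)"
      using x by (auto intro!: derivative_eq_intros simp: power2_eq_square)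
    note inv = this
    have "((\<lambda>x. poly P (1 / x) * exp (- (1 / x))) has_real_derivative
        flat_exp (monom 1 2 * (P - pderiv P)) x) (at x)"
      by (rule DERIV_cong[OF DERIV_mult[OF DERIV_chain2[OF poly_DERIV inv] DERIV_chain2[OF DERIV_exp DERIV_minus[OF inv]]]])
         (use x in \<open>simp add: flat_exp_def poly_monom algebra_simps\<close>)
    moreover have "eventually (\<lambda>y. flat_exp P y = poly P (1 / y) * exp (- (1 / y))) (nhds x)"
      using x eventually_nhds_in_open[of "{0<..}" x]
      by (auto simp: flat_exp_def elim!: eventually_mono)
    ultimately show ?thesis by (rule DERIV_transform_nhds)
  qed
qed

lemma bump_algebra_derivative:
  assumes "h \<in> bump_algebra"
  shows "\<exists>h'\<in>bump_algebra. \<forall>x. (h has_real_derivative h' x) (at x)"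
  using assms
proof induction
  case (left P)
  show ?case using has_derivative_flat_exp[of P] bump_algebra.left by blast
next
  case (right P)
  let ?Q = "monom 1 2 * (P - pderiv P)"
  have neg: "- flat_exp ?Q (1 - x) = flat_exp (- ?Q) (1 - x)" for x
    by (simp add: flat_exp_def)
  have "((\<lambda>x. flat_exp P (1 - x)) has_real_derivative flat_exp (- ?Q) (1 - x)) (at x)" for x
    unfolding neg[symmetric]
    by (rule DERIV_cong[OF DERIV_chain2[OF has_derivative_flat_exp]])
       (auto intro!: derivative_eq_intros)
  then show ?case by (intro bexI[OF _ bump_algebra.right] allI)
next
  case (add f g)
  then obtain f' g' where "f' \<in> bump_algebra" "g' \<in> bump_algebra"
    "\<And>x. (f has_real_derivative f' x) (at x)" "\<And>x. (g has_real_derivative g' x) (at x)" by blast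
  then show ?case by (intro bexI[of _ "\<lambda>x. f' x + g' x"] bump_algebra.add) (auto intro: DERIV_add)
next
  case (mult f g)
  then obtain f' g' where *: "f' \<in> bump_algebra" "g' \<in> bump_algebra"
    "\<And>x. (f has_real_derivative f' x) (at x)" "\<And>x. (g has_real_derivative g' x) (at x)" by blast
  show ?case
    by (intro bexI[of _ "\<lambda>x. f' x * g x + g' x * f x"] bump_algebra.add bump_algebra.mult mult * allI DERIV_mult)
qed

text \<open>The function \<open>g\<close> is the derivative of the bump \<open>e\<^bsup>-1/x\<^esup> e\<^bsup>-1/(1-x)\<^esup>\<close>. Its integral is \<open>0\<close> because the
bump vanishes at both ends, and it is not identically \<open>0\<close> because the bump is positive at \<open>1/2\<close>.\<close>

lemma mean_zero_bump:
  obtains g g' :: "real \<Rightarrow> real" where "g \<in> bump_algebra"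
    "\<And>x. (g has_real_derivative g' x) (at x)" "continuous_on UNIV g'"
    "\<And>x. x \<notin> {0..1} \<Longrightarrow> g x = 0" "\<And>x. x \<notin> {0..1} \<Longrightarrow> g' x = 0"
    "integral {0..1} g = 0" "integral {0..1} (\<lambda>x. (g x)^2) > 0"
proof -
  let ?\<psi> = "\<lambda>x. flat_exp 1 x * flat_exp 1 (1 - x)"
  have \<psi>: "?\<psi> \<in> bump_algebra" by (intro bump_algebra.intros)
  obtain g where g: "g \<in> bump_algebra" "\<And>x. (?\<psi> has_real_derivative g x) (at x)"
    using bump_algebra_derivative[OF \<psi>] by blast
  obtain g' where g': "g' \<in> bump_algebra" "\<And>x. (g has_real_derivative g' x) (at x)"
    using bump_algebra_derivative[OF g(1)] by blast
  obtain g'' where "\<And>x. (g' has_real_derivative g'' x) (at x)"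
    using bump_algebra_derivative[OF g'(1)] by blast
  then have cg': "continuous_on UNIV g'"
    by (intro DERIV_continuous_on) (auto intro: has_field_derivative_at_within)
  have cg: "continuous_on UNIV g"
    using g'(2) by (intro DERIV_continuous_on) (auto intro: has_field_derivative_at_within)
  \<comment> \<open>Applied to the bump and then to \<open>g\<close>: a derivative vanishes wherever the function vanishes nearby.\<close>
  have off: "h' x = 0"
    if h: "\<And>x. x \<notin> {0..1} \<Longrightarrow> h x = 0" "\<And>x. (h has_real_derivative h' x) (at x)"
      and x: "x \<notin> {0..1}" for h h' :: "real \<Rightarrow> real" and x
  proof -
    have "eventually (\<lambda>y. y \<in> - {0..1::real}) (nhds x)"
      using x by (intro eventually_nhds_in_open) auto
    then have "eventually (\<lambda>y. h y = 0) (nhds x)"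
      by eventually_elim (use h(1) in auto)
    with DERIV_const have "(h has_real_derivative 0) (at x)"
      by (rule DERIV_transform_nhds)
    with h(2) show ?thesis by (rule DERIV_unique)
  qed
  have zero: "g x = 0" if "x \<notin> {0..1}" for x
    by (rule off[OF _ g(2) that]) (auto simp: flat_exp_def)
  have zero': "g' x = 0" if "x \<notin> {0..1}" for x
    by (rule off[OF zero g'(2) that])
  have int: "(g has_integral ?\<psi> b - ?\<psi> a) {a..b}" if "a \<le> b" for a b
    by (intro fundamental_theorem_of_calculus that)
       (use g(2) in \<open>auto simp: has_real_derivative_iff_has_vector_derivative[symmetric] intro: has_field_derivative_at_within\<close>)
  have "integral {0..1} g = 0" using integral_unique[OF int[of 0 1]] by (simp add: flat_exp_def)
  have csq: "continuous_on {0..1} (\<lambda>x. (g x)^2)"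
    by (intro continuous_intros continuous_on_subset[OF cg]) auto
  have "integral {0..1} (\<lambda>x. (g x)^2) \<noteq> 0"
  proof
    assume "integral {0..1} (\<lambda>x. (g x)^2) = 0"
    then have "\<forall>x\<in>{0..1}. (g x)^2 = 0"
      using integral_eq_0_iff[OF csq] by auto
    then have "(g has_integral 0) {0..1/2}"
      by (intro has_integral_is_0) auto
    moreover have "(g has_integral ?\<psi> (1/2) - ?\<psi> 0) {0..1/2}"
      by (rule int) simp
    ultimately have "?\<psi> (1/2) - ?\<psi> 0 = 0" by (rule has_integral_unique[symmetric])
    then show False by (simp add: flat_exp_def)
  qed
  moreover have "integral {0..1} (\<lambda>x. (g x)^2) \<ge> 0"
    by (intro integral_nonneg integrable_continuous_real csq) auto
  ultimately show thesis
    using that[OF g(1) g'(2) cg' zero zero' \<open>integral {0..1} g = 0\<close>] by linarith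
qed


section \<open>Instability\<close>

lemma surf_integral_cyl_domain:
  assumes "\<And>p. p \<notin> piece_domain L \<Longrightarrow> p \<in> cyl_domain \<Longrightarrow> F p = 0"
  shows "surf_integral X cyl_domain F = surf_integral X (piece_domain L) F"
proof -
  have "piece_domain L \<subseteq> cyl_domain" by (auto simp: piece_domain_def cyl_domain_def)
  then have "indicator cyl_domain p *\<^sub>R (F p * area_density X p) =
      indicator (piece_domain L) p *\<^sub>R (F p * area_density X p)" for p
    using assms[of p] by (auto simp: indicator_def)
  then show ?thesis unfolding surf_integral_def set_lebesgue_integral_def by presburger
qed

text \<open>With \<open>w(t) = g(t/L)\<close> the form is a positive multiple of \<open>A/L\<^sup>2 - B/r\<^sup>2\<close>, where \<open>A\<close> and \<open>B\<close> are the
integrals of \<open>g'\<^sup>2\<close> and \<open>g\<^sup>2\<close>; it becomes negative for large \<open>L\<close>.\<close>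

lemma cylinder_not_stable:
  assumes "R > 0"
  shows "\<not> cylinder_stable R"
proof -
  have sc: "sinh R > 0" "cosh R > 0" using assms by auto
  obtain g g' :: "real \<Rightarrow> real" where g: "g \<in> bump_algebra"
    and dg: "\<And>x. (g has_real_derivative g' x) (at x)" and cg': "continuous_on UNIV g'"
    and off: "\<And>x. x \<notin> {0..1} \<Longrightarrow> g x = 0" "\<And>x. x \<notin> {0..1} \<Longrightarrow> g' x = 0"
    and mean: "integral {0..1} g = 0" and pos: "integral {0..1} (\<lambda>x. (g x)^2) > 0"
    using mean_zero_bump by blast
  have cg: "continuous_on UNIV g"
    using dg by (intro DERIV_continuous_on) (auto intro: has_field_derivative_at_within)
  define A where "A = integral {0..1} (\<lambda>x. (g' x)^2)"
  define B where "B = integral {0..1} (\<lambda>x. (g x)^2)"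
  have hA: "((\<lambda>x. (g' x)^2) has_integral A) {0..1}"
    unfolding A_def by (intro integrable_integral integrable_continuous_real continuous_intros
        continuous_on_subset[OF cg']) auto
  have hB: "((\<lambda>x. (g x)^2) has_integral B) {0..1}"
    unfolding B_def by (intro integrable_integral integrable_continuous_real continuous_intros
        continuous_on_subset[OF cg]) auto
  have hg: "(g has_integral 0) {0..1}"
    using integrable_integral[OF integrable_continuous_real, of 0 1 g] mean continuous_on_subset[OF cg] by simp
  have A: "A \<ge> 0" by (rule has_integral_nonneg[OF hA]) simp
  have B: "B > 0" using pos by (simp add: B_def)
  \<comment> \<open>Since \<open>L \<ge> 1\<close>, already \<open>L > A r\<^sup>2 / B\<close> implies \<open>L\<^sup>2 > A r\<^sup>2 / B\<close>.\<close>
  define L where "L = 1 + A * (sinh R)^2 / B"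
  have L: "L \<ge> 1" using A B by (simp add: L_def)
  have LL: "A / L^2 - B / (sinh R)^2 < 0"
  proof -
    have "A * (sinh R)^2 / B < L" by (simp add: L_def)
    also have "\<dots> \<le> L^2" using L by (simp add: power2_eq_square)
    finally show ?thesis using B L sc by (simp add: field_simps)
  qed
  define w where "w t = g (t / L)" for t
  define w' where "w' t = g' (t / L) / L" for t
  have dw: "(w has_real_derivative w' t) (at t)" for t
    unfolding w_def[abs_def] w'_def
    using DERIV_chain2[OF dg, of "\<lambda>t. t / L" "1 / L" t UNIV] DERIV_cdivide[OF DERIV_ident, of L t UNIV]
    by simp
  have cw: "continuous_on S w" and cw': "continuous_on S w'" for S
    unfolding w_def[abs_def] w'_def[abs_def] using L
    by (auto intro!: continuous_intros continuous_on_compose2[OF cg] continuous_on_compose2[OF cg'])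
  have woff: "w t = 0" "w' t = 0" if "t \<notin> {0..L}" for t
  proof -
    have "t / L \<notin> {0..1}" using that L by (auto simp: zero_le_divide_iff)
    then show "w t = 0" "w' t = 0" using off by (auto simp: w_def w'_def)
  qed
  have scale: "((\<lambda>t. F (t / L)) has_integral I * L) {0..L}" if "(F has_integral I) {0..1}" for F I
    using has_integral_affinity'[of F I 0 1 "1 / L" 0] that L by (simp add: field_simps)
  define f where "f x = w (ln (x $ 3))" for x :: "real^3"
  have f: "f \<circ> killing_param R = (\<lambda>p. w (p $ 1))"
    by (simp add: f_def fun_eq_iff killing_param_height)
  have "f \<in> compact_test_functions R"
  proof -
    have sm: "smooth (\<lambda>p::real^2. w (p $ 1))"
    \<comment> \<open>The factor \<open>a\<close> absorbs the powers of \<open>1/L\<close> produced by differentiating \<open>h (t / L)\<close>.\<close>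
    proof (rule smooth_comp_fst)
      show "w \<in> {\<lambda>t. a * h (t / L) | a h. h \<in> bump_algebra}"
        using g by (auto simp: w_def[abs_def] intro!: exI[of _ 1] exI[of _ g])
      fix h assume "h \<in> {\<lambda>t. a * h (t / L) | a h. h \<in> bump_algebra}"
      then obtain a h0 where h: "h = (\<lambda>t. a * h0 (t / L))" "h0 \<in> bump_algebra" by blast
      then obtain h1 where h1: "h1 \<in> bump_algebra" "\<And>x. (h0 has_real_derivative h1 x) (at x)"
        using bump_algebra_derivative by blast
      have der: "(h has_real_derivative (a / L) * h1 (t / L)) (at t)" for t
        unfolding h(1)
        using DERIV_cmult[OF DERIV_chain2[OF h1(2), of "\<lambda>t. t / L" "1 / L" t UNIV], of a]
          DERIV_cdivide[OF DERIV_ident, of L t UNIV]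
        by simp
      have mem: "(\<lambda>t. (a / L) * h1 (t / L)) \<in> {\<lambda>t. a * h (t / L) | a h. h \<in> bump_algebra}"
        using h1(1) by blast
      show "\<exists>h'\<in>{\<lambda>t. a * h (t / L) | a h. h \<in> bump_algebra}. \<forall>x. (h has_real_derivative h' x) (at x)"
        by (rule bexI[OF _ mem]) (intro allI der)
    qed
    have "compact (killing_piece R L)"
      unfolding killing_piece_def
    proof (rule compact_continuous_image)
      have "piece_domain L = cbox (vector [0, 0]) (vector [L, 2 * pi])"
        by (auto simp: piece_domain_def mem_box_cart forall_2)
      then show "compact (piece_domain L)" by simp
      have eq: "killing_param R = (\<lambda>p. (exp (p $ 1) * (sinh R * cos (p $ 2))) *\<^sub>R axis 1 1
          + (exp (p $ 1) * (sinh R * sin (p $ 2))) *\<^sub>R axis 2 1 + exp (p $ 1) *\<^sub>R axis 3 1)"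
        by (simp add: killing_param_def fun_eq_iff vec_eq_iff forall_3 axis_def)
      show "continuous_on (piece_domain L) (killing_param R)"
        unfolding eq by (intro continuous_intros)
    qed
    moreover have "killing_piece R L \<subseteq> killing_cylinder R"
      by (auto simp: killing_piece_def killing_cylinder_def piece_domain_def cyl_domain_def)
    moreover have "f x = 0" if "x \<in> killing_cylinder R - killing_piece R L" for x
    proof -
      from that obtain p where "x = killing_param R p" "killing_param R p \<notin> killing_piece R L"
        by (auto simp: killing_cylinder_def)
      then show ?thesis using woff(1)[of "p $ 1"]
        by (auto simp: f_def killing_param_height killing_param_in_piece_iff)
    qed
    ultimately show ?thesis
      using sm f unfolding compact_test_functions_def by (auto intro!: exI[of _ "killing_piece R L"])
  qed
  moreover have "surf_integral (killing_param R) cyl_domain (f \<circ> killing_param R) = 0"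
  proof -
    have "surf_integral (killing_param R) cyl_domain (\<lambda>p. w (p $ 1)) =
        surf_integral (killing_param R) (piece_domain L) (\<lambda>p. w (p $ 1))"
      by (rule surf_integral_cyl_domain) (auto intro!: woff simp: piece_domain_def cyl_domain_def)
    also have "\<dots> = 2 * pi * integral {0..L} (\<lambda>t. w t * (cosh R * sinh R))"
      using L by (intro surf_integral_fst assms cw) auto
    also have "integral {0..L} (\<lambda>t. w t * (cosh R * sinh R)) = 0 * L * (cosh R * sinh R)"
      unfolding w_def by (intro integral_unique has_integral_mult_left scale hg)
    finally show ?thesis unfolding f by simp
  qed
  moreover have "jacobi_form (killing_param R) cyl_domain (f \<circ> killing_param R) < 0"
  proof -
    have "jacobi_form (killing_param R) cyl_domain (\<lambda>p. w (p $ 1)) =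
        jacobi_form (killing_param R) (piece_domain L) (\<lambda>p. w (p $ 1))"
      unfolding jacobi_form_def
    proof (rule surf_integral_cyl_domain)
      fix p assume "p \<notin> piece_domain L" "p \<in> cyl_domain"
      then have "p $ 1 \<notin> {0..L}" by (auto simp: piece_domain_def cyl_domain_def)
      then show "grad_norm2 (killing_param R) (\<lambda>p. w (p $ 1)) p
          - (second_ff_norm2 (killing_param R) p - 2) * (w (p $ 1))\<^sup>2 = 0"
        by (simp add: grad_norm2_def sum_2 pd_2_comp_fst pd_comp_fst[OF dw] woff)
    qed
    also have "\<dots> = 2 * pi * integral {0..L} (\<lambda>t. ((w' t)^2 / (cosh R)^2 -
        (w t)^2 / ((cosh R)^2 * (sinh R)^2)) * (cosh R * sinh R))"
      using L by (intro jacobi_form_fst assms cw cw' dw) auto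
    also have "integral {0..L} (\<lambda>t. ((w' t)^2 / (cosh R)^2 -
        (w t)^2 / ((cosh R)^2 * (sinh R)^2)) * (cosh R * sinh R)) =
        (A * L / L^2 / (cosh R)^2 - B * L / ((cosh R)^2 * (sinh R)^2)) * (cosh R * sinh R)"
      unfolding w_def w'_def power_divide
      by (intro integral_unique has_integral_mult_left has_integral_diff has_integral_divide scale hA hB)
    also have "\<dots> = (A / L^2 - B / (sinh R)^2) * (L / (cosh R)^2 * (cosh R * sinh R))"
      by (simp add: divide_inverse algebra_simps)
    also have "2 * pi * \<dots> < 0"
      using LL L sc by (intro mult_pos_neg mult_neg_pos) auto
    finally show ?thesis unfolding f .
  qed
  ultimately show ?thesis unfolding cylinder_stable_def by (meson not_le)
qed

theorem theorem4p1:
  fixes R T :: real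
  assumes "R > 0" and "T > 0"
  shows "morse_index R T = enat (eta R T) \<and>
         (T > pi * sinh R \<longrightarrow> morse_index R T \<noteq> 0 \<and> \<not> piece_strongly_stable R T) \<and>
         (T > 2 * pi * sinh R \<longrightarrow> \<not> piece_stable R T) \<and>
         \<not> cylinder_stable R"
proof -
  have s: "sinh R > 0" using assms by simp
  have neg: "\<not> 0 \<le> jacobi_form (killing_param R) (piece_domain T) (sine_mode R T k \<circ> killing_param R)"
    if "k \<ge> 1" "real k * (pi * sinh R) < T" for k
  proof -
    have "mode_eigenvalue R T k < 0"
      using that s assms by (simp add: mode_eigenvalue_negative_iff pos_less_divide_eq)
    then show ?thesis using sine_mode_jacobi_form_negative[OF assms that(1)] by simp
  qed
  have "morse_index R T \<noteq> 0" if "T > pi * sinh R"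
  proof -
    have "1 \<le> eta R T" using that s assms by (simp add: le_eta_iff pos_less_divide_eq)
    then show ?thesis by (simp add: morse_index_eq_eta[OF assms] enat_0_iff)
  qed
  moreover have "\<not> piece_strongly_stable R T" if "T > pi * sinh R"
    using neg[of 1] that sine_mode_dirichlet[OF assms] unfolding piece_strongly_stable_def by auto
  moreover have "\<not> piece_stable R T" if "T > 2 * pi * sinh R"
    using neg[of 2] that sine_mode_dirichlet[OF assms] sine_mode_2_mean_zero[OF assms]
    unfolding piece_stable_def by (auto simp: mult.assoc)
  ultimately show ?thesis
    using morse_index_eq_eta[OF assms] cylinder_not_stable[OF assms(1)] by blast
qed

end
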